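(* The functor $\Phi:\mathcal{PMV}\to\mathcal{PEMV}$, given by $\Phi(N,I)=I$ on objects and $\Phi(\phi)(x)=\phi(x)$ for $x\in I_1$ on morphisms $\phi:(N_1,I_1)\to(N_2,I_2)$, defines a categorical equivalence of the category $\mathcal{PMV}$ and the category $\mathcal{PEMV}$ of proper $EMV$-algebras. In addition, if $h:\Phi(N,I)\to\Phi(N',I')$ is a morphism of proper $EMV$-algebras, then there is a unique homomorphism $\phi:(N,I)\to(N',I')$ of $MV$-algebras (a morphism of $\mathcal{PMV}$) such that $h=\Phi(\phi)$, and (i) if $h$ is surjective, so is $\phi$; (ii) if $h$ is injective, so is $\phi$.
   Context: An $MV$-algebra is an algebra $(A;\oplus,',0,1)$ of type $(2,1,0,0)$ such that $(A;\oplus,0)$ is a commutative monoid and, for all $x,y\in A$, $x''=x$, $x\oplus 1=1$ and $x\oplus(x\oplus y')'=y\oplus(y\oplus x')'$; it is a lattice under the order $x\le y\Leftrightarrow x'\oplus y=1$. An ideal of an $MV$-algebra is a non-empty down-closed subset closed under $\oplus$; a maximal ideal is a proper ideal not properly contained in another proper ideal. An algebra $(M;\vee,\wedge,\oplus,0)$ of type $(2,2,2,0)$ is an $EMV$-algebra if: (1) $(M;\vee,\wedge,0)$ is a distributive lattice with least element $0$; (2) $(M;\oplus,0)$ is a commutative ordered monoid with neutral element $0$; (3) writing $\mathcal I(M)=\{a\in M: a\oplus a=a\}$, for all $a\le b$ in $\mathcal I(M)$ and all $x\in[a,b]$ the element $\lambda_{a,b}(x)=\min\{z\in[a,b]: x\oplus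 z=b\}$ exists in $M$, and $([a,b];\oplus,\lambda_{a,b},a,b)$ is an $MV$-algebra; (4) each $x\in M$ lies below some $a\in\mathcal I(M)$. We write $\lambda_b:=\lambda_{0,b}$. An $EMV$-algebra is proper if it has no greatest element. An $EMV$-homomorphism is a map $f$ preserving $\vee,\wedge,\oplus,0$ with $f(\lambda_b(x))=\lambda_{f(b)}(f(x))$ for all idempotents $b$ and all $x\in[0,b]$. $\mathcal{PEMV}$ is the category whose objects are proper $EMV$-algebras and whose morphisms are $EMV$-homomorphisms. $\mathcal{PMV}$ is the category whose objects are couples $(N,I)$, where $N$ is an $MV$-algebra and $I$ is a fixed maximal ideal of $N$ having enough idempotent elements (for each $x\in I$ there is an idempotent $a\in I$ with $x\le a$) such that $N=I\cup\{x':x\in I\}$. A morphism $(N_1,I_1)\to(N_2,I_2)$ is an $MV$-homomorphism $\phi:N_1\to N_2$ with $\phi(I_1)\subseteq I_2$. Such an $I$ is regarded as an $EMV$-algebra with the operations $\vee,\wedge,\oplus,0$ inherited from $N$.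
   Formalization: Objects (N,I) of PMV are also required to have I without greatest element, since otherwise Φ(N,I)=I need not be proper (N={0,1}, I={0}); the MV-algebra axioms include 0'=1, which the stated order needs for reflexivity. *)

theory Defs
  imports "HOL-Algebra.Group"
begin

section \<open>Categories, functors and equivalences\<close>

text \<open>
  Hom-sets are indexed by their end points and need not be disjoint; accordingly identities,
  composition and the morphism part of a functor take the objects involved as arguments.
  \<open>Comp C X Y Z g f\<close> is the composite of \<open>f : X \<rightarrow> Y\<close> followed by \<open>g : Y \<rightarrow> Z\<close>.
\<close>

record ('o, 'm) cat =
  Obj :: "'o set"
  Hom :: "'o \<Rightarrow> 'o \<Rightarrow> 'm set"
  Ident :: "'o \<Rightarrow> 'm"
  Comp :: "'o \<Rightarrow> 'o \<Rightarrow> 'o \<Rightarrow> 'm \<Rightarrow> 'm \<Rightarrow> 'm"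

locale is_category =
  fixes C :: "('o, 'm) cat"
  assumes Ident_in_Hom: "X \<in> Obj C \<Longrightarrow> Ident C X \<in> Hom C X X"
    and Comp_in_Hom:
      "\<lbrakk>X \<in> Obj C; Y \<in> Obj C; Z \<in> Obj C; f \<in> Hom C X Y; g \<in> Hom C Y Z\<rbrakk>
        \<Longrightarrow> Comp C X Y Z g f \<in> Hom C X Z"
    and Comp_Ident_right:
      "\<lbrakk>X \<in> Obj C; Y \<in> Obj C; f \<in> Hom C X Y\<rbrakk> \<Longrightarrow> Comp C X X Y f (Ident C X) = f"
    and Comp_Ident_left:
      "\<lbrakk>X \<in> Obj C; Y \<in> Obj C; f \<in> Hom C X Y\<rbrakk> \<Longrightarrow> Comp C X Y Y (Ident C Y) f = f"
    and Comp_assoc: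
      "\<lbrakk>W \<in> Obj C; X \<in> Obj C; Y \<in> Obj C; Z \<in> Obj C;
        f \<in> Hom C W X; g \<in> Hom C X Y; h \<in> Hom C Y Z\<rbrakk>
        \<Longrightarrow> Comp C W Y Z h (Comp C W X Y g f) = Comp C W X Z (Comp C X Y Z h g) f"

definition is_iso :: "('o, 'm) cat \<Rightarrow> 'o \<Rightarrow> 'o \<Rightarrow> 'm \<Rightarrow> bool" where
  "is_iso C X Y f \<longleftrightarrow> f \<in> Hom C X Y \<and>
     (\<exists>g \<in> Hom C Y X. Comp C X Y X g f = Ident C X \<and> Comp C Y X Y f g = Ident C Y)"

record ('o, 'm, 'p, 'n) fctr =
  on_obj :: "'o \<Rightarrow> 'p"
  on_mor :: "'o \<Rightarrow> 'o \<Rightarrow> 'm \<Rightarrow> 'n"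

locale is_functor = dom: is_category C + cod: is_category D
  for C :: "('o, 'm) cat" and D :: "('p, 'n) cat" +
  fixes F :: "('o, 'm, 'p, 'n) fctr"
  assumes on_obj_in_Obj: "X \<in> Obj C \<Longrightarrow> on_obj F X \<in> Obj D"
    and on_mor_in_Hom:
      "\<lbrakk>X \<in> Obj C; Y \<in> Obj C; f \<in> Hom C X Y\<rbrakk>
        \<Longrightarrow> on_mor F X Y f \<in> Hom D (on_obj F X) (on_obj F Y)"
    and on_mor_Ident: "X \<in> Obj C \<Longrightarrow> on_mor F X X (Ident C X) = Ident D (on_obj F X)"
    and on_mor_Comp:
      "\<lbrakk>X \<in> Obj C; Y \<in> Obj C; Z \<in> Obj C; f \<in> Hom C X Y; g \<in> Hom C Y Z\<rbrakk>
        \<Longrightarrow> on_mor F X Z (Comp C X Y Z g f) =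
            Comp D (on_obj F X) (on_obj F Y) (on_obj F Z) (on_mor F Y Z g) (on_mor F X Y f)"

definition id_fctr :: "('o, 'm, 'o, 'm) fctr" where
  "id_fctr = \<lparr>on_obj = (\<lambda>X. X), on_mor = (\<lambda>X Y f. f)\<rparr>"

definition comp_fctr ::
  "('p, 'n, 'q, 'k) fctr \<Rightarrow> ('o, 'm, 'p, 'n) fctr \<Rightarrow> ('o, 'm, 'q, 'k) fctr" where
  "comp_fctr G F =
     \<lparr>on_obj = (\<lambda>X. on_obj G (on_obj F X)),
      on_mor = (\<lambda>X Y f. on_mor G (on_obj F X) (on_obj F Y) (on_mor F X Y f))\<rparr>"

definition is_natural_iso ::
  "('o, 'm) cat \<Rightarrow> ('p, 'n) cat \<Rightarrow> ('o, 'm, 'p, 'n) fctr \<Rightarrow> ('o, 'm, 'p, 'n) fctr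
    \<Rightarrow> ('o \<Rightarrow> 'n) \<Rightarrow> bool" where
  "is_natural_iso C D F G \<eta> \<longleftrightarrow>
     (\<forall>X \<in> Obj C. is_iso D (on_obj F X) (on_obj G X) (\<eta> X)) \<and>
     (\<forall>X \<in> Obj C. \<forall>Y \<in> Obj C. \<forall>f \<in> Hom C X Y.
        Comp D (on_obj F X) (on_obj F Y) (on_obj G Y) (\<eta> Y) (on_mor F X Y f) =
        Comp D (on_obj F X) (on_obj G X) (on_obj G Y) (on_mor G X Y f) (\<eta> X))"

definition is_equivalence ::
  "('o, 'm) cat \<Rightarrow> ('p, 'n) cat \<Rightarrow> ('o, 'm, 'p, 'n) fctr \<Rightarrow> bool" where
  "is_equivalence C D F \<longleftrightarrow> is_functor C D F \<and>
     (\<exists>G. is_functor D C G \<and>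
        (\<exists>\<eta>. is_natural_iso C C id_fctr (comp_fctr G F) \<eta>) \<and>
        (\<exists>\<epsilon>. is_natural_iso D D (comp_fctr F G) id_fctr \<epsilon>))"


section \<open>MV-algebras\<close>

record 'a oplus_alg = "'a partial_object" +
  oplus :: "'a \<Rightarrow> 'a \<Rightarrow> 'a" (infixl "\<oplus>\<index>" 65)
  ozero :: "'a" ("\<zero>\<index>")

record 'a mv_alg = "'a oplus_alg" +
  mv_neg :: "'a \<Rightarrow> 'a"
  mv_one :: "'a"

definition oplus_monoid :: "('a, 'b) oplus_alg_scheme \<Rightarrow> 'a monoid" where
  "oplus_monoid A = \<lparr>carrier = carrier A, mult = oplus A, one = ozero A\<rparr>"

definition idems :: "('a, 'b) oplus_alg_scheme \<Rightarrow> 'a set" where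
  "idems A = {a \<in> carrier A. a \<oplus>\<^bsub>A\<^esub> a = a}"

text \<open>
  The axiom \<open>0' = 1\<close> is part of the definition because the equations without it do not make
  \<open>x \<le> y \<longleftrightarrow> x' \<oplus> y = 1\<close> reflexive, let alone a lattice order: reflexivity at \<open>0\<close>
  is precisely \<open>0' = 1\<close>, and there is a four-element model of the others in which it fails.
\<close>

locale is_mv_algebra =
  fixes N :: "'a mv_alg"
  assumes oplus_comm_monoid: "comm_monoid (oplus_monoid N)"
    and neg_closed: "x \<in> carrier N \<Longrightarrow> mv_neg N x \<in> carrier N"
    and one_closed: "mv_one N \<in> carrier N"
    and neg_zero: "mv_neg N (ozero N) = mv_one N"
    and neg_neg: "x \<in> carrier N \<Longrightarrow> mv_neg N (mv_neg N x) = x"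
    and oplus_one: "x \<in> carrier N \<Longrightarrow> x \<oplus>\<^bsub>N\<^esub> mv_one N = mv_one N"
    and lukasiewicz:
      "\<lbrakk>x \<in> carrier N; y \<in> carrier N\<rbrakk> \<Longrightarrow>
        x \<oplus>\<^bsub>N\<^esub> mv_neg N (x \<oplus>\<^bsub>N\<^esub> mv_neg N y) = y \<oplus>\<^bsub>N\<^esub> mv_neg N (y \<oplus>\<^bsub>N\<^esub> mv_neg N x)"

definition mv_order :: "'a mv_alg \<Rightarrow> 'a gorder" where
  "mv_order N =
     \<lparr>carrier = carrier N, eq = (=), le = (\<lambda>x y. mv_neg N x \<oplus>\<^bsub>N\<^esub> y = mv_one N)\<rparr>"

definition mv_hom :: "'a mv_alg \<Rightarrow> 'b mv_alg \<Rightarrow> ('a \<Rightarrow> 'b) set" where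
  "mv_hom N N' =
     {f \<in> carrier N \<rightarrow>\<^sub>E carrier N'.
        (\<forall>x \<in> carrier N. \<forall>y \<in> carrier N. f (x \<oplus>\<^bsub>N\<^esub> y) = f x \<oplus>\<^bsub>N'\<^esub> f y) \<and>
        (\<forall>x \<in> carrier N. f (mv_neg N x) = mv_neg N' (f x)) \<and>
        f (ozero N) = ozero N' \<and> f (mv_one N) = mv_one N'}"

definition mv_ideal :: "'a mv_alg \<Rightarrow> 'a set \<Rightarrow> bool" where
  "mv_ideal N I \<longleftrightarrow> I \<subseteq> carrier N \<and> I \<noteq> {} \<and>
     (\<forall>x \<in> I. \<forall>y \<in> carrier N. y \<sqsubseteq>\<^bsub>mv_order N\<^esub> x \<longrightarrow> y \<in> I) \<and>
     (\<forall>x \<in> I. \<forall>y \<in> I. x \<oplus>\<^bsub>N\<^esub> y \<in> I)"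

definition mv_proper_ideal :: "'a mv_alg \<Rightarrow> 'a set \<Rightarrow> bool" where
  "mv_proper_ideal N I \<longleftrightarrow> mv_ideal N I \<and> I \<noteq> carrier N"

definition mv_maximal_ideal :: "'a mv_alg \<Rightarrow> 'a set \<Rightarrow> bool" where
  "mv_maximal_ideal N I \<longleftrightarrow> mv_proper_ideal N I \<and> \<not> (\<exists>J. mv_proper_ideal N J \<and> I \<subset> J)"


section \<open>EMV-algebras\<close>

record 'a emv_alg = "'a oplus_alg" +
  emv_join :: "'a \<Rightarrow> 'a \<Rightarrow> 'a"
  emv_meet :: "'a \<Rightarrow> 'a \<Rightarrow> 'a"

definition emv_order :: "'a emv_alg \<Rightarrow> 'a gorder" where
  "emv_order M = \<lparr>carrier = carrier M, eq = (=), le = (\<lambda>x y. emv_meet M x y = x)\<rparr>"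

locale is_distrib_lattice =
  fixes M :: "'a emv_alg"
  assumes join_closed: "\<lbrakk>x \<in> carrier M; y \<in> carrier M\<rbrakk> \<Longrightarrow> emv_join M x y \<in> carrier M"
    and meet_closed: "\<lbrakk>x \<in> carrier M; y \<in> carrier M\<rbrakk> \<Longrightarrow> emv_meet M x y \<in> carrier M"
    and join_comm: "\<lbrakk>x \<in> carrier M; y \<in> carrier M\<rbrakk> \<Longrightarrow> emv_join M x y = emv_join M y x"
    and meet_comm: "\<lbrakk>x \<in> carrier M; y \<in> carrier M\<rbrakk> \<Longrightarrow> emv_meet M x y = emv_meet M y x"
    and join_assoc:
      "\<lbrakk>x \<in> carrier M; y \<in> carrier M; z \<in> carrier M\<rbrakk>
        \<Longrightarrow> emv_join M (emv_join M x y) z = emv_join M x (emv_join M y z)"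
    and meet_assoc:
      "\<lbrakk>x \<in> carrier M; y \<in> carrier M; z \<in> carrier M\<rbrakk>
        \<Longrightarrow> emv_meet M (emv_meet M x y) z = emv_meet M x (emv_meet M y z)"
    and join_absorb: "\<lbrakk>x \<in> carrier M; y \<in> carrier M\<rbrakk> \<Longrightarrow> emv_join M x (emv_meet M x y) = x"
    and meet_absorb: "\<lbrakk>x \<in> carrier M; y \<in> carrier M\<rbrakk> \<Longrightarrow> emv_meet M x (emv_join M x y) = x"
    and meet_join_distrib:
      "\<lbrakk>x \<in> carrier M; y \<in> carrier M; z \<in> carrier M\<rbrakk>
        \<Longrightarrow> emv_meet M x (emv_join M y z) = emv_join M (emv_meet M x y) (emv_meet M x z)"

definition lam_set :: "'a emv_alg \<Rightarrow> 'a \<Rightarrow> 'a \<Rightarrow> 'a \<Rightarrow> 'a set" where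
  "lam_set M a b x = {z \<in> \<lbrace>a..b\<rbrace>\<^bsub>emv_order M\<^esub>. x \<oplus>\<^bsub>M\<^esub> z = b}"

definition lam :: "'a emv_alg \<Rightarrow> 'a \<Rightarrow> 'a \<Rightarrow> 'a \<Rightarrow> 'a" where
  "lam M a b x = (THE z. least (emv_order M) z (lam_set M a b x))"

definition interval_mv :: "'a emv_alg \<Rightarrow> 'a \<Rightarrow> 'a \<Rightarrow> 'a mv_alg" where
  "interval_mv M a b =
     \<lparr>carrier = \<lbrace>a..b\<rbrace>\<^bsub>emv_order M\<^esub>, oplus = oplus M, ozero = a, mv_neg = lam M a b, mv_one = b\<rparr>"

locale is_emv_algebra = is_distrib_lattice +
  assumes zero_least: "least (emv_order M) (ozero M) (carrier M)"
    and oplus_comm_monoid: "comm_monoid (oplus_monoid M)"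
    and oplus_mono:
      "\<lbrakk>x \<in> carrier M; y \<in> carrier M; z \<in> carrier M; x \<sqsubseteq>\<^bsub>emv_order M\<^esub> y\<rbrakk>
        \<Longrightarrow> x \<oplus>\<^bsub>M\<^esub> z \<sqsubseteq>\<^bsub>emv_order M\<^esub> y \<oplus>\<^bsub>M\<^esub> z"
    and lam_exists:
      "\<lbrakk>a \<in> idems M; b \<in> idems M; a \<sqsubseteq>\<^bsub>emv_order M\<^esub> b; x \<in> \<lbrace>a..b\<rbrace>\<^bsub>emv_order M\<^esub>\<rbrakk>
        \<Longrightarrow> \<exists>z. least (emv_order M) z (lam_set M a b x)"
    and interval_is_mv:
      "\<lbrakk>a \<in> idems M; b \<in> idems M; a \<sqsubseteq>\<^bsub>emv_order M\<^esub> b\<rbrakk> \<Longrightarrow> is_mv_algebra (interval_mv M a b)"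
    and enough_idems: "x \<in> carrier M \<Longrightarrow> \<exists>a \<in> idems M. x \<sqsubseteq>\<^bsub>emv_order M\<^esub> a"

definition is_proper_emv :: "'a emv_alg \<Rightarrow> bool" where
  "is_proper_emv M \<longleftrightarrow> is_emv_algebra M \<and> \<not> (\<exists>g. greatest (emv_order M) g (carrier M))"

definition emv_hom :: "'a emv_alg \<Rightarrow> 'b emv_alg \<Rightarrow> ('a \<Rightarrow> 'b) set" where
  "emv_hom M M' =
     {f \<in> carrier M \<rightarrow>\<^sub>E carrier M'.
        (\<forall>x \<in> carrier M. \<forall>y \<in> carrier M. f (emv_join M x y) = emv_join M' (f x) (f y)) \<and>
        (\<forall>x \<in> carrier M. \<forall>y \<in> carrier M. f (emv_meet M x y) = emv_meet M' (f x) (f y)) \<and>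
        (\<forall>x \<in> carrier M. \<forall>y \<in> carrier M. f (x \<oplus>\<^bsub>M\<^esub> y) = f x \<oplus>\<^bsub>M'\<^esub> f y) \<and>
        f (ozero M) = ozero M' \<and>
        (\<forall>b \<in> idems M. \<forall>x \<in> \<lbrace>ozero M..b\<rbrace>\<^bsub>emv_order M\<^esub>.
           f (lam M (ozero M) b x) = lam M' (ozero M') (f b) (f x))}"


section \<open>The two categories and the functor between them\<close>

text \<open>
  The objects are the algebras whose carrier is a set over the type \<open>'a\<close>, which is arbitrary.
  Morphisms are extensional functions, so that they are equal as soon as they agree on the carrier.
\<close>

definition PEMV :: "('a emv_alg, 'a \<Rightarrow> 'a) cat" where
  "PEMV =
     \<lparr>Obj = {M. is_proper_emv M},
      Hom = emv_hom,
      Ident = (\<lambda>M. \<lambda>x \<in> carrier M. x),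
      Comp = (\<lambda>M1 M2 M3 g f. compose (carrier M1) g f)\<rparr>"

definition pmv_couple :: "'a mv_alg \<Rightarrow> 'a set \<Rightarrow> bool" where
  "pmv_couple N I \<longleftrightarrow> is_mv_algebra N \<and> mv_maximal_ideal N I \<and>
     (\<forall>x \<in> I. \<exists>a \<in> I \<inter> idems N. x \<sqsubseteq>\<^bsub>mv_order N\<^esub> a) \<and>
     carrier N = I \<union> mv_neg N ` I"

text \<open>
  The requirement that \<open>I\<close> has no greatest element has to be added to \<^const>\<open>pmv_couple\<close> for the
  functor below to have values in proper EMV-algebras: for the two-element MV-algebra
  \<open>N = {0, 1}\<close> and \<open>I = {0}\<close>, the couple \<open>(N, I)\<close> satisfies \<^const>\<open>pmv_couple\<close>, but
  \<open>I\<close> has a greatest element.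
\<close>

definition PMV :: "('a mv_alg \<times> 'a set, 'a \<Rightarrow> 'a) cat" where
  "PMV =
     \<lparr>Obj = {(N, I). pmv_couple N I \<and> \<not> (\<exists>g. greatest (mv_order N) g I)},
      Hom = (\<lambda>(N1, I1) (N2, I2). {\<phi> \<in> mv_hom N1 N2. \<phi> ` I1 \<subseteq> I2}),
      Ident = (\<lambda>(N, I). \<lambda>x \<in> carrier N. x),
      Comp = (\<lambda>(N1, I1) (N2, I2) (N3, I3) g f. compose (carrier N1) g f)\<rparr>"

definition ideal_emv :: "'a mv_alg \<Rightarrow> 'a set \<Rightarrow> 'a emv_alg" where
  "ideal_emv N I =
     \<lparr>carrier = I, oplus = oplus N, ozero = ozero N,
      emv_join = (\<lambda>x y. x \<squnion>\<^bsub>mv_order N\<^esub> y),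
      emv_meet = (\<lambda>x y. x \<sqinter>\<^bsub>mv_order N\<^esub> y)\<rparr>"

definition Phi :: "('a mv_alg \<times> 'a set, 'a \<Rightarrow> 'a, 'a emv_alg, 'a \<Rightarrow> 'a) fctr" where
  "Phi =
     \<lparr>on_obj = (\<lambda>(N, I). ideal_emv N I),
      on_mor = (\<lambda>(N1, I1) (N2, I2) \<phi>. restrict \<phi> I1)\<rparr>"

end

theory Submission
  imports Defs
begin

text \<open>
  If \<open>(N, I)\<close> is an object, then \<open>N\<close> is the disjoint union of \<open>I\<close> and the set of complements of
  elements of \<open>I\<close>, so a morphism is determined by its restriction to \<open>I\<close>. Conversely, sums of
  elements and complements reduce to the operations \<open>x \<ominus> y\<close> and \<open>x \<odot> y\<close> on \<open>I\<close>, and for any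
  idempotent \<open>b \<in> I\<close> above \<open>x\<close> and \<open>y\<close> these can be computed in \<open>[0, b]\<close> as
  \<open>\<lambda>\<^sub>b (\<lambda>\<^sub>b x \<oplus> y)\<close> and \<open>\<lambda>\<^sub>b (\<lambda>\<^sub>b x \<oplus> \<lambda>\<^sub>b y)\<close>. Hence an EMV-homomorphism extends by complements,
  and the functor is fully faithful.

  For essential surjectivity, add formal complements to a proper EMV-algebra \<open>M\<close>. The elements of
  \<open>[0, b]\<close> and their complements form a copy of the product of \<open>[0, b]\<close> with the two-element
  algebra, where the complement of \<open>x\<close> corresponds to \<open>(\<lambda>\<^sub>b x, 1)\<close>, and any three elements lie in
  one such copy; so the MV-axioms hold. A proper EMV-algebra is infinite, so the doubled set
  can be encoded in \<open>M\<close> itself.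
\<close>

section \<open>Equivalences of categories\<close>

text \<open>The quasi-inverse is obtained by choice: pick a preimage up to isomorphism for every
  object of \<open>D\<close>, conjugate morphisms by the chosen isomorphisms and lift them along
  \<open>F\<close>. Equations in \<open>C\<close> are checked after applying \<open>F\<close>, which
  is faithful.\<close>

lemma equivalence_if_fully_faithful_ess_surj:
  assumes F: "is_functor C D F"
    and ff: "\<And>X Y g. \<lbrakk>X \<in> Obj C; Y \<in> Obj C; g \<in> Hom D (on_obj F X) (on_obj F Y)\<rbrakk>
      \<Longrightarrow> \<exists>!f. f \<in> Hom C X Y \<and> on_mor F X Y f = g"
    and es: "\<And>Z. Z \<in> Obj D \<Longrightarrow> \<exists>X \<in> Obj C. \<exists>e. is_iso D (on_obj F X) Z e"
  shows "is_equivalence C D F"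
proof -
  interpret F: is_functor C D F by (rule F)
  let ?F = "on_obj F"
  note [simp, intro] = F.on_obj_in_Obj F.on_mor_in_Hom F.dom.Ident_in_Hom F.cod.Ident_in_Hom
    F.dom.Comp_in_Hom F.cod.Comp_in_Hom
  obtain G0 e d where G0 [simp, intro]: "\<And>Z. Z \<in> Obj D \<Longrightarrow> G0 Z \<in> Obj C"
    and e [simp, intro]: "\<And>Z. Z \<in> Obj D \<Longrightarrow> e Z \<in> Hom D (?F (G0 Z)) Z"
    and d [simp, intro]: "\<And>Z. Z \<in> Obj D \<Longrightarrow> d Z \<in> Hom D Z (?F (G0 Z))"
    and de: "\<And>Z. Z \<in> Obj D \<Longrightarrow> Comp D (?F (G0 Z)) Z (?F (G0 Z)) (d Z) (e Z) = Ident D (?F (G0 Z))"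
    and ed: "\<And>Z. Z \<in> Obj D \<Longrightarrow> Comp D Z (?F (G0 Z)) Z (e Z) (d Z) = Ident D Z"
    using es unfolding is_iso_def by metis
  define lift where "lift X Y g = (THE f. f \<in> Hom C X Y \<and> on_mor F X Y f = g)" for X Y g
  have lift: "lift X Y g \<in> Hom C X Y" "on_mor F X Y (lift X Y g) = g"
    if "X \<in> Obj C" "Y \<in> Obj C" "g \<in> Hom D (?F X) (?F Y)" for X Y g
    using theI'[OF ff[OF that]] unfolding lift_def by auto
  have faithful: "f = f'"
    if "X \<in> Obj C" "Y \<in> Obj C" "f \<in> Hom C X Y" "f' \<in> Hom C X Y"
      "on_mor F X Y f = on_mor F X Y f'" for X Y f f'
    using ff[of X Y "on_mor F X Y f"] that by auto
  \<comment> \<open>Conjugation of \<open>f\<close> by the chosen isomorphisms; \<open>G\<close>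
    will send \<open>f\<close> to the lift of this. The rules \<open>e_cj\<close> and
    \<open>cj_d\<close> are the naturality squares of \<open>e\<close> and \<open>d\<close>.\<close>
  define cj where "cj Z W f = Comp D (?F (G0 Z)) W (?F (G0 W)) (d W) (Comp D (?F (G0 Z)) Z W f (e Z))"
    for Z W f
  have cj [simp, intro]: "cj Z W f \<in> Hom D (?F (G0 Z)) (?F (G0 W))"
    if "Z \<in> Obj D" "W \<in> Obj D" "f \<in> Hom D Z W" for Z W f
    using that by (auto simp: cj_def)
  have e_cj: "Comp D (?F (G0 Z)) (?F (G0 W)) W (e W) (cj Z W f) = Comp D (?F (G0 Z)) Z W f (e Z)"
    if "Z \<in> Obj D" "W \<in> Obj D" "f \<in> Hom D Z W" for Z W f
    using that by (simp add: cj_def F.cod.Comp_assoc ed F.cod.Comp_Ident_left)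
  have cj_d: "Comp D Z (?F (G0 Z)) (?F (G0 W)) (cj Z W f) (d Z) = Comp D Z W (?F (G0 W)) (d W) f"
    if "Z \<in> Obj D" "W \<in> Obj D" "f \<in> Hom D Z W" for Z W f
    using that by (simp add: cj_def ed F.cod.Comp_Ident_right flip: F.cod.Comp_assoc)
  define G where "G = \<lparr>on_obj = G0, on_mor = (\<lambda>Z W f. lift (G0 Z) (G0 W) (cj Z W f))\<rparr>"
  have G_simps [simp]: "on_obj G = G0" "on_mor G Z W f = lift (G0 Z) (G0 W) (cj Z W f)" for Z W f
    by (simp_all add: G_def)
  have "is_functor D C G"
  proof unfold_locales
    fix Z assume Z: "Z \<in> Obj D"
    then have "cj Z Z (Ident D Z) = Ident D (?F (G0 Z))"
      by (simp add: cj_def F.cod.Comp_Ident_left de)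
    then show "on_mor G Z Z (Ident D Z) = Ident C (on_obj G Z)"
      using Z by (intro faithful[of "G0 Z" "G0 Z"]) (simp_all add: lift F.on_mor_Ident)
  next
    fix X Y Z f g
    assume *: "X \<in> Obj D" "Y \<in> Obj D" "Z \<in> Obj D" "f \<in> Hom D X Y" "g \<in> Hom D Y Z"
    \<comment> \<open>Naturality of \<open>d\<close> moves it across \<open>g\<close>; the factors
      left over form \<open>cj X Y f\<close>.\<close>
    have "cj X Z (Comp D X Y Z g f) = Comp D (?F (G0 X)) Y (?F (G0 Z)) (Comp D Y Z (?F (G0 Z)) (d Z) g)
        (Comp D (?F (G0 X)) X Y f (e X))"
      using * by (simp add: cj_def F.cod.Comp_assoc)
    also have "\<dots> = Comp D (?F (G0 X)) Y (?F (G0 Z))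
        (Comp D Y (?F (G0 Y)) (?F (G0 Z)) (cj Y Z g) (d Y)) (Comp D (?F (G0 X)) X Y f (e X))"
      using * by (simp add: cj_d)
    also have "\<dots> = Comp D (?F (G0 X)) (?F (G0 Y)) (?F (G0 Z)) (cj Y Z g) (cj X Y f)"
      using * by (simp add: F.cod.Comp_assoc cj_def[of X Y])
    finally show "on_mor G X Z (Comp D X Y Z g f) =
        Comp C (on_obj G X) (on_obj G Y) (on_obj G Z) (on_mor G Y Z g) (on_mor G X Y f)"
      using * by (intro faithful[of "G0 X" "G0 Z"]) (simp_all add: lift F.on_mor_Comp)
  qed (simp_all add: lift)
  moreover
  \<comment> \<open>The unit at \<open>X\<close> lifts \<open>d (?F X)\<close>; its inverse is the
    lift of \<open>e (?F X)\<close>, because \<open>de\<close> and \<open>ed\<close> give the two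
    equations after applying \<open>F\<close>.\<close>
  define \<eta> where "\<eta> X = lift X (G0 (?F X)) (d (?F X))" for X
  have \<eta>: "\<eta> X \<in> Hom C X (G0 (?F X))" "on_mor F X (G0 (?F X)) (\<eta> X) = d (?F X)"
    if "X \<in> Obj C" for X
    using lift[of X "G0 (?F X)" "d (?F X)"] that by (simp_all add: \<eta>_def)
  have "is_natural_iso C C id_fctr (comp_fctr G F) \<eta>"
    unfolding is_natural_iso_def id_fctr_def comp_fctr_def
  proof (intro conjI ballI, goal_cases)
    case (1 X)
    let ?k = "lift (G0 (?F X)) X (e (?F X))"
    have k: "?k \<in> Hom C (G0 (?F X)) X" "on_mor F (G0 (?F X)) X ?k = e (?F X)"
      using 1 lift[of "G0 (?F X)" X] by simp_all
    have "Comp C X (G0 (?F X)) X ?k (\<eta> X) = Ident C X"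
      using 1 k \<eta>[of X] by (intro faithful[of X X]) (simp_all add: F.on_mor_Comp F.on_mor_Ident ed)
    moreover have "Comp C (G0 (?F X)) X (G0 (?F X)) (\<eta> X) ?k = Ident C (G0 (?F X))"
      using 1 k \<eta>[of X] by (intro faithful[of "G0 (?F X)" "G0 (?F X)"]) (simp_all add: F.on_mor_Comp F.on_mor_Ident de)
    ultimately show ?case
      using k \<eta>[of X] 1 unfolding is_iso_def by auto
  next
    case (2 X Y f)
    then show ?case
      using \<eta>[of X] \<eta>[of Y]
      by (auto intro!: faithful[of X "G0 (?F Y)"] simp: F.on_mor_Comp lift cj_d)
  qed
  moreover
  have "is_natural_iso D D (comp_fctr F G) id_fctr e"
    unfolding is_natural_iso_def id_fctr_def comp_fctr_def
  proof (intro conjI ballI, goal_cases)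
    case (1 X)
    then show ?case using de ed unfolding is_iso_def by auto
  next
    case (2 X Y f)
    then show ?case by (simp add: lift e_cj)
  qed
  ultimately show ?thesis
    using F unfolding is_equivalence_def by blast
qed

section \<open>Arithmetic of MV-algebras\<close>

context is_mv_algebra
begin

abbreviation add (infixl "\<boxplus>" 65) where "x \<boxplus> y \<equiv> x \<oplus>\<^bsub>N\<^esub> y"
abbreviation neg ("\<sim> _" [81] 80) where "\<sim> x \<equiv> mv_neg N x"
abbreviation one ("\<one>\<^sub>N") where "\<one>\<^sub>N \<equiv> mv_one N"
abbreviation below (infix "\<preceq>" 50) where "x \<preceq> y \<equiv> x \<sqsubseteq>\<^bsub>mv_order N\<^esub> y"

text \<open>On the real unit interval these are max(0, x - y) and max(0, x + y - 1). The difference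
  is the basic operation here because ideals are closed under it, whereas they are not closed under
  complements.\<close>

definition diff (infixl "\<ominus>" 65) where "x \<ominus> y = \<sim> (\<sim> x \<boxplus> y)"
definition prod2 (infixl "\<odot>" 70) where "x \<odot> y = \<sim> (\<sim> x \<boxplus> \<sim> y)"
definition sup2 (infixl "\<curlyvee>" 60) where "x \<curlyvee> y = x \<boxplus> (y \<ominus> x)"
definition inf2 (infixl "\<curlywedge>" 60) where "x \<curlywedge> y = x \<ominus> (x \<ominus> y)"

section \<open>Monoid laws, natural order and truncated difference\<close>

lemma below_iff: "x \<preceq> y \<longleftrightarrow> \<sim> x \<boxplus> y = \<one>\<^sub>N"
  by (simp add: mv_order_def)

lemma add_closed [simp, intro]: "\<lbrakk>x \<in> carrier N; y \<in> carrier N\<rbrakk> \<Longrightarrow> x \<boxplus> y \<in> carrier N"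
  using comm_monoid.axioms(1)[OF oplus_comm_monoid, THEN monoid.m_closed]
  by (simp add: oplus_monoid_def)

lemma zero_closed [simp, intro]: "\<zero>\<^bsub>N\<^esub> \<in> carrier N"
  using comm_monoid.axioms(1)[OF oplus_comm_monoid, THEN monoid.one_closed]
  by (simp add: oplus_monoid_def)

lemma add_zero [simp]: "x \<in> carrier N \<Longrightarrow> x \<boxplus> \<zero>\<^bsub>N\<^esub> = x"
  using comm_monoid.axioms(1)[OF oplus_comm_monoid, THEN monoid.r_one]
  by (simp add: oplus_monoid_def)

lemma zero_add [simp]: "x \<in> carrier N \<Longrightarrow> \<zero>\<^bsub>N\<^esub> \<boxplus> x = x"
  using comm_monoid.axioms(1)[OF oplus_comm_monoid, THEN monoid.l_one]
  by (simp add: oplus_monoid_def)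

lemma add_comm: "\<lbrakk>x \<in> carrier N; y \<in> carrier N\<rbrakk> \<Longrightarrow> x \<boxplus> y = y \<boxplus> x"
  using comm_monoid.m_comm[OF oplus_comm_monoid] by (simp add: oplus_monoid_def)

lemma add_assoc:
  "\<lbrakk>x \<in> carrier N; y \<in> carrier N; z \<in> carrier N\<rbrakk> \<Longrightarrow> x \<boxplus> y \<boxplus> z = x \<boxplus> (y \<boxplus> z)"
  using comm_monoid.axioms(1)[OF oplus_comm_monoid, THEN monoid.m_assoc]
  by (simp add: oplus_monoid_def)

lemma add_left_comm:
  "\<lbrakk>x \<in> carrier N; y \<in> carrier N; z \<in> carrier N\<rbrakk> \<Longrightarrow> x \<boxplus> (y \<boxplus> z) = y \<boxplus> (x \<boxplus> z)"
  by (metis add_assoc add_comm)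

lemmas add_ac = add_assoc add_comm add_left_comm

declare neg_closed [simp, intro] one_closed [simp, intro] neg_zero [simp] neg_neg [simp]
  oplus_one [simp]

lemma neg_one [simp]: "\<sim> \<one>\<^sub>N = \<zero>\<^bsub>N\<^esub>"
  by (metis neg_neg neg_zero zero_closed)

lemma one_add [simp]: "x \<in> carrier N \<Longrightarrow> \<one>\<^sub>N \<boxplus> x = \<one>\<^sub>N"
  by (simp add: add_comm[of "\<one>\<^sub>N"])

text \<open>Put one for \<open>y\<close> in \<open>lukasiewicz\<close>: the right side collapses to
  one.\<close>

lemma neg_add_self [simp]: "x \<in> carrier N \<Longrightarrow> \<sim> x \<boxplus> x = \<one>\<^sub>N"
  using lukasiewicz[of x "\<one>\<^sub>N"] by (simp add: add_comm[of "\<sim> x"])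

lemma add_neg_self [simp]: "x \<in> carrier N \<Longrightarrow> x \<boxplus> \<sim> x = \<one>\<^sub>N"
  using neg_add_self[of x] by (simp add: add_comm)

lemma diff_closed [simp, intro]: "\<lbrakk>x \<in> carrier N; y \<in> carrier N\<rbrakk> \<Longrightarrow> x \<ominus> y \<in> carrier N"
  by (simp add: diff_def)

lemma add_neg_right: "\<lbrakk>x \<in> carrier N; y \<in> carrier N\<rbrakk> \<Longrightarrow> x \<boxplus> \<sim> y = \<sim> (y \<ominus> x)"
  by (simp add: diff_def add_comm)

lemma add_neg_left: "\<lbrakk>x \<in> carrier N; y \<in> carrier N\<rbrakk> \<Longrightarrow> \<sim> x \<boxplus> y = \<sim> (x \<ominus> y)"
  by (simp add: diff_def)

lemma add_neg_neg: "\<lbrakk>x \<in> carrier N; y \<in> carrier N\<rbrakk> \<Longrightarrow> \<sim> x \<boxplus> \<sim> y = \<sim> (x \<odot> y)"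
  by (simp add: prod2_def)

lemma sup2_closed [simp, intro]: "\<lbrakk>x \<in> carrier N; y \<in> carrier N\<rbrakk> \<Longrightarrow> x \<curlyvee> y \<in> carrier N"
  by (simp add: sup2_def)

lemma inf2_closed [simp, intro]: "\<lbrakk>x \<in> carrier N; y \<in> carrier N\<rbrakk> \<Longrightarrow> x \<curlywedge> y \<in> carrier N"
  by (simp add: inf2_def)

text \<open>The Lukasiewicz axiom rewritten with differences; it is what makes the join
  symmetric.\<close>

lemma add_diff_comm:
  assumes "x \<in> carrier N" "y \<in> carrier N" shows "x \<boxplus> (y \<ominus> x) = y \<boxplus> (x \<ominus> y)"
  using lukasiewicz[OF assms] assms by (simp add: diff_def add_comm)

lemma below_refl [simp]: "x \<in> carrier N \<Longrightarrow> x \<preceq> x"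
  by (simp add: below_iff)

lemma diff_eq_zero_iff:
  assumes "x \<in> carrier N" "y \<in> carrier N" shows "x \<ominus> y = \<zero>\<^bsub>N\<^esub> \<longleftrightarrow> x \<preceq> y"
  using assms unfolding diff_def below_iff
  by (metis add_closed neg_closed neg_neg neg_one neg_zero)

text \<open>With \<open>x \<ominus> y\<close> equal to zero, \<open>add_diff_comm\<close> leaves
  \<open>y\<close>. So the order is the natural order of the monoid, and transitivity and
  monotonicity of the sum follow by regrouping summands.\<close>

lemma add_diff_cancel:
  assumes "x \<in> carrier N" "y \<in> carrier N" "x \<preceq> y" shows "x \<boxplus> (y \<ominus> x) = y"
  using add_diff_comm[of x y] assms diff_eq_zero_iff[of x y] by simp

lemma below_add [simp]:
  assumes "x \<in> carrier N" "y \<in> carrier N" shows "x \<preceq> x \<boxplus> y" 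
  using assms by (simp add: below_iff flip: add_assoc)

lemma below_add' [simp]:
  assumes "x \<in> carrier N" "y \<in> carrier N" shows "y \<preceq> x \<boxplus> y" 
  using assms by (metis add_comm below_add)

lemma below_antisym:
  assumes "x \<in> carrier N" "y \<in> carrier N" "x \<preceq> y" "y \<preceq> x" shows "x = y"
  using assms by (metis add_diff_cancel add_diff_comm)

lemma below_trans:
  assumes "x \<preceq> y" "y \<preceq> z" "x \<in> carrier N" "y \<in> carrier N" "z \<in> carrier N" shows "x \<preceq> z"
proof -
  have "z = (x \<boxplus> (y \<ominus> x)) \<boxplus> (z \<ominus> y)"
    using assms by (simp add: add_diff_cancel)
  also have "\<dots> = x \<boxplus> ((y \<ominus> x) \<boxplus> (z \<ominus> y))"
    using assms by (simp add: add_assoc)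
  finally show ?thesis
    using assms below_add[of x "(y \<ominus> x) \<boxplus> (z \<ominus> y)"] by simp
qed

lemma zero_below [simp]: "x \<in> carrier N \<Longrightarrow> \<zero>\<^bsub>N\<^esub> \<preceq> x"
  by (simp add: below_iff)

lemma below_one [simp]: "x \<in> carrier N \<Longrightarrow> x \<preceq> \<one>\<^sub>N"
  by (simp add: below_iff)

lemma neg_below_iff:
  "\<lbrakk>x \<in> carrier N; y \<in> carrier N\<rbrakk> \<Longrightarrow> \<sim> x \<preceq> \<sim> y \<longleftrightarrow> y \<preceq> x"
  by (simp add: below_iff add_comm)

text \<open>Both sides unfold to the same threefold sum being one. Through this residuation,
  inequalities about differences become inequalities about sums.\<close>

lemma diff_below_iff:
  "\<lbrakk>x \<in> carrier N; y \<in> carrier N; z \<in> carrier N\<rbrakk> \<Longrightarrow> x \<ominus> y \<preceq> z \<longleftrightarrow> x \<preceq> y \<boxplus> z"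
  by (simp add: below_iff diff_def add_assoc)

lemma add_mono:
  assumes "x \<preceq> x'" "y \<preceq> y'" "x \<in> carrier N" "x' \<in> carrier N" "y \<in> carrier N" "y' \<in> carrier N"
  shows "x \<boxplus> y \<preceq> x' \<boxplus> y'"
proof -
  have "x' \<boxplus> y' = (x \<boxplus> y) \<boxplus> ((x' \<ominus> x) \<boxplus> (y' \<ominus> y))"
  proof -
    have "(x \<boxplus> y) \<boxplus> ((x' \<ominus> x) \<boxplus> (y' \<ominus> y)) = (x \<boxplus> (x' \<ominus> x)) \<boxplus> (y \<boxplus> (y' \<ominus> y))"
      using assms by (simp add: add_ac)
    then show ?thesis using assms by (simp add: add_diff_cancel)
  qed
  then show ?thesis
    using assms below_add[of "x \<boxplus> y" "(x' \<ominus> x) \<boxplus> (y' \<ominus> y)"] by simp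
qed

lemma diff_below [simp]: "\<lbrakk>x \<in> carrier N; y \<in> carrier N\<rbrakk> \<Longrightarrow> x \<ominus> y \<preceq> x"
  by (simp add: diff_below_iff)

lemma diff_add:
  "\<lbrakk>x \<in> carrier N; y \<in> carrier N; z \<in> carrier N\<rbrakk> \<Longrightarrow> x \<ominus> (y \<boxplus> z) = (x \<ominus> y) \<ominus> z"
  by (simp add: diff_def add_assoc)

text \<open>Dual to \<open>add_diff_cancel\<close>: the Lukasiewicz axiom for
  \<open>\<sim> x\<close> and \<open>\<sim> y\<close>, where \<open>y \<preceq> x\<close> reduces
  one side to \<open>\<sim> y\<close>.\<close>

lemma diff_diff_cancel:
  assumes "x \<in> carrier N" "y \<in> carrier N" "y \<preceq> x" shows "x \<ominus> (x \<ominus> y) = y"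
  using lukasiewicz[of "\<sim> x" "\<sim> y"] assms by (simp add: diff_def below_iff)

section \<open>The distributive lattice of an MV-algebra\<close>

lemma sup2_least:
  assumes "x \<preceq> z" "y \<preceq> z" "x \<in> carrier N" "y \<in> carrier N" "z \<in> carrier N"
  shows "x \<curlyvee> y \<preceq> z"
proof -
  have "y \<ominus> x \<preceq> z \<ominus> x"
    using assms by (simp add: diff_below_iff add_diff_cancel)
  then have "x \<boxplus> (y \<ominus> x) \<preceq> x \<boxplus> (z \<ominus> x)"
    using assms by (simp add: add_mono)
  then show ?thesis
    using assms by (simp add: sup2_def add_diff_cancel)
qed

lemma sup2_upper [simp]:
  assumes "x \<in> carrier N" "y \<in> carrier N"
  shows "x \<preceq> x \<curlyvee> y" "y \<preceq> x \<curlyvee> y"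
  using assms below_add[of x "y \<ominus> x"] below_add[of y "x \<ominus> y"] add_diff_comm[of x y]
  by (simp_all add: sup2_def)

lemma below_add_diff [simp]: "\<lbrakk>x \<in> carrier N; y \<in> carrier N\<rbrakk> \<Longrightarrow> x \<preceq> y \<boxplus> (x \<ominus> y)"
  using sup2_upper(2)[of y x] by (simp add: sup2_def)

text \<open>De Morgan duality, through which the bounds for meets are inherited from those for
  joins.\<close>

lemma inf2_conv_sup2:
  "\<lbrakk>x \<in> carrier N; y \<in> carrier N\<rbrakk> \<Longrightarrow> x \<curlywedge> y = \<sim> (\<sim> x \<curlyvee> \<sim> y)"
  by (simp add: inf2_def sup2_def diff_def add_comm)

lemma inf2_lower [simp]:
  assumes "x \<in> carrier N" "y \<in> carrier N"
  shows "x \<curlywedge> y \<preceq> x" "x \<curlywedge> y \<preceq> y"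
  using assms neg_below_iff[of "\<sim> x \<curlyvee> \<sim> y" "\<sim> x"] neg_below_iff[of "\<sim> x \<curlyvee> \<sim> y" "\<sim> y"]
  by (simp_all add: inf2_conv_sup2)

lemma inf2_greatest:
  assumes "z \<preceq> x" "z \<preceq> y" "x \<in> carrier N" "y \<in> carrier N" "z \<in> carrier N"
  shows "z \<preceq> x \<curlywedge> y"
  using assms neg_below_iff[of "\<sim> z" "\<sim> x \<curlyvee> \<sim> y"]
  by (simp add: inf2_conv_sup2 sup2_least neg_below_iff)

lemma sup2_below_iff [simp]:
  assumes "x \<in> carrier N" "y \<in> carrier N" "z \<in> carrier N"
  shows "x \<curlyvee> y \<preceq> z \<longleftrightarrow> x \<preceq> z \<and> y \<preceq> z"
  using assms sup2_least[of x z y] below_trans[of x "x \<curlyvee> y" z] below_trans[of y "x \<curlyvee> y" z]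
  by auto

lemma below_inf2_iff [simp]:
  assumes "x \<in> carrier N" "y \<in> carrier N" "z \<in> carrier N"
  shows "z \<preceq> x \<curlywedge> y \<longleftrightarrow> z \<preceq> x \<and> z \<preceq> y"
  using assms inf2_greatest[of z x y] below_trans[of z "x \<curlywedge> y" x] below_trans[of z "x \<curlywedge> y" y]
  by auto

lemma eq_if_same_uppers:
  assumes "x \<in> carrier N" "y \<in> carrier N" "\<And>z. z \<in> carrier N \<Longrightarrow> x \<preceq> z \<longleftrightarrow> y \<preceq> z"
  shows "x = y"
  using assms(1,2) assms(3)[of x] assms(3)[of y] by (simp add: below_antisym)

lemma eq_if_same_lowers:
  assumes "x \<in> carrier N" "y \<in> carrier N" "\<And>z. z \<in> carrier N \<Longrightarrow> z \<preceq> x \<longleftrightarrow> z \<preceq> y"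
  shows "x = y"
  using assms(1,2) assms(3)[of x] assms(3)[of y] by (simp add: below_antisym)

lemma sup2_assoc:
  assumes "x \<in> carrier N" "y \<in> carrier N" "z \<in> carrier N"
  shows "x \<curlyvee> y \<curlyvee> z = x \<curlyvee> (y \<curlyvee> z)"
  by (rule eq_if_same_uppers) (use assms in simp_all)

lemma inf2_assoc:
  assumes "x \<in> carrier N" "y \<in> carrier N" "z \<in> carrier N"
  shows "x \<curlywedge> y \<curlywedge> z = x \<curlywedge> (y \<curlywedge> z)"
  by (rule eq_if_same_lowers) (use assms in simp_all)

lemma sup2_absorb: "\<lbrakk>x \<in> carrier N; y \<in> carrier N\<rbrakk> \<Longrightarrow> y \<preceq> x \<Longrightarrow> x \<curlyvee> y = x"
  by (rule below_antisym) simp_all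

lemma inf2_comm:
  assumes "x \<in> carrier N" "y \<in> carrier N" shows "x \<curlywedge> y = y \<curlywedge> x"
  by (rule below_antisym) (use assms in simp_all)

lemma inf2_eq_iff:
  assumes "x \<in> carrier N" "y \<in> carrier N" shows "x \<curlywedge> y = x \<longleftrightarrow> x \<preceq> y"
  using assms
  by (metis below_antisym below_refl inf2_closed inf2_greatest inf2_lower)

lemma diff_mono_left:
  assumes "x \<preceq> y" "x \<in> carrier N" "y \<in> carrier N" "z \<in> carrier N"
  shows "x \<ominus> z \<preceq> y \<ominus> z"
  using assms below_trans[of x y "z \<boxplus> (y \<ominus> z)"] by (simp add: diff_below_iff)

lemma diff_antimono_right:
  assumes "x \<preceq> y" "x \<in> carrier N" "y \<in> carrier N" "z \<in> carrier N"
  shows "z \<ominus> y \<preceq> z \<ominus> x"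
  using assms below_trans[of z "x \<boxplus> (z \<ominus> x)" "y \<boxplus> (z \<ominus> x)"]
  by (simp add: diff_below_iff add_mono)

text \<open>Subtracting a fixed element is a left adjoint, and \<open>x \<curlywedge> y\<close> is an iterated difference.\<close>
lemma inf2_sup2_distrib:
  assumes c: "x \<in> carrier N" "y \<in> carrier N" "z \<in> carrier N"
  shows "x \<curlywedge> (y \<curlyvee> z) = (x \<curlywedge> y) \<curlyvee> (x \<curlywedge> z)"
proof (rule below_antisym)
  let ?j = "y \<curlyvee> z" and ?r = "(y \<curlywedge> x) \<curlyvee> (z \<curlywedge> x)"
  \<comment> \<open>Once \<open>y\<close> and \<open>z\<close> lie below
    \<open>(?j \<ominus> x) \<boxplus> ?r\<close>, so does their join \<open>?j\<close>, and
    residuation turns this into \<open>?j \<curlywedge> x \<preceq> ?r\<close>.\<close>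
  have y: "y \<preceq> (?j \<ominus> x) \<boxplus> ?r"
  proof -
    have "y \<ominus> (?j \<ominus> x) \<preceq> y \<ominus> (y \<ominus> x)"
      using c by (simp add: diff_mono_left diff_antimono_right)
    also have "y \<ominus> (y \<ominus> x) \<preceq> ?r"
      using c by (simp flip: inf2_def)
    finally (below_trans) show ?thesis using c by (simp add: diff_below_iff)
  qed
  have z: "z \<preceq> (?j \<ominus> x) \<boxplus> ?r"
  proof -
    have "z \<ominus> (?j \<ominus> x) \<preceq> z \<ominus> (z \<ominus> x)"
      using c by (simp add: diff_mono_left diff_antimono_right)
    also have "z \<ominus> (z \<ominus> x) \<preceq> ?r"
      using c by (simp flip: inf2_def)
    finally (below_trans) show ?thesis using c by (simp add: diff_below_iff)
  qed
  have "?j \<preceq> (?j \<ominus> x) \<boxplus> ?r"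
    using y z c by (simp add: sup2_least)
  then have "?j \<curlywedge> x \<preceq> ?r"
    using c by (simp add: diff_below_iff inf2_def)
  then show "x \<curlywedge> ?j \<preceq> (x \<curlywedge> y) \<curlyvee> (x \<curlywedge> z)"
    using c by (simp add: inf2_comm)
  have "x \<curlywedge> y \<preceq> x \<curlywedge> ?j" "x \<curlywedge> z \<preceq> x \<curlywedge> ?j"
    using c below_trans[OF inf2_lower(2) sup2_upper(1)[of y z], of x]
      below_trans[OF inf2_lower(2) sup2_upper(2)[of y z], of x]
    by (simp_all add: inf2_greatest)
  then show "(x \<curlywedge> y) \<curlyvee> (x \<curlywedge> z) \<preceq> x \<curlywedge> ?j"
    using c by (simp add: sup2_least)
qed (use c in auto)

section \<open>Joins and meets of \<open>mv_order\<close> as terms\<close>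

lemma carrier_mv_order [simp]: "carrier (mv_order N) = carrier N"
  by (simp add: mv_order_def)

lemma partial_order_mv_order: "partial_order (mv_order N)"
proof -
  have eq: "(.=\<^bsub>mv_order N\<^esub>) = (=)"
    by (simp add: mv_order_def)
  show ?thesis
    by unfold_locales (auto simp: eq intro: below_antisym below_trans)
qed

lemma join_eq:
  assumes "x \<in> carrier N" "y \<in> carrier N" shows "x \<squnion>\<^bsub>mv_order N\<^esub> y = x \<curlyvee> y"
proof -
  have "least (mv_order N) (x \<curlyvee> y) (Upper (mv_order N) {x, y})"
    using assms by (auto simp: least_def Upper_def sup2_least)
  then show ?thesis
    unfolding join_def sup_def
    by (rule some_equality) (meson \<open>least _ _ _\<close> partial_order.least_unique partial_order_mv_order)
qed

lemma meet_eq: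
  assumes "x \<in> carrier N" "y \<in> carrier N" shows "x \<sqinter>\<^bsub>mv_order N\<^esub> y = x \<curlywedge> y"
proof -
  have "greatest (mv_order N) (x \<curlywedge> y) (Lower (mv_order N) {x, y})"
    using assms by (auto simp: greatest_def Lower_def inf2_greatest)
  then show ?thesis
    unfolding meet_def inf_def
    by (rule some_equality) (meson \<open>greatest _ _ _\<close> partial_order.greatest_unique partial_order_mv_order)
qed

section \<open>Idempotents and complements relative to them\<close>

lemma idem_add_absorb:
  assumes "b \<in> idems N" "x \<in> carrier N" "x \<preceq> b" shows "x \<boxplus> b = b"
  using assms add_mono[of x b b b] by (auto simp: idems_def intro: below_antisym)

text \<open>Split \<open>x\<close> as \<open>a \<boxplus> (x \<ominus> a)\<close>; the extra
  \<open>a\<close> merges with the first summand.\<close>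

lemma idem_add_absorb':
  assumes "a \<in> idems N" "x \<in> carrier N" "a \<preceq> x" shows "x \<boxplus> a = x"
proof -
  have a: "a \<in> carrier N" "a \<boxplus> a = a"
    using assms by (auto simp: idems_def)
  have "a \<boxplus> (a \<boxplus> (x \<ominus> a)) = a \<boxplus> (x \<ominus> a)"
    using a assms by (simp flip: add_assoc)
  then show ?thesis
    using a assms by (simp add: add_diff_cancel add_comm)
qed

lemma idems_closed: "b \<in> idems N \<Longrightarrow> b \<in> carrier N"
  by (simp add: idems_def)

text \<open>Idempotents are Boolean: \<open>\<sim> b\<close> and \<open>b\<close> meet in zero,
  while the excess of \<open>\<sim> b \<boxplus> \<sim> b\<close> over \<open>\<sim> b\<close> lies
  below both of them.\<close>

lemma idem_neg:
  assumes "b \<in> idems N" shows "\<sim> b \<in> idems N"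
proof -
  have b: "b \<in> carrier N" "b \<boxplus> b = b" using assms by (auto simp: idems_def)
  have "\<sim> b \<curlywedge> b = \<zero>\<^bsub>N\<^esub>"
    using b by (simp add: inf2_def diff_def)
  moreover have "\<sim> b \<boxplus> \<sim> b \<ominus> \<sim> b \<preceq> \<sim> b \<curlywedge> b"
    using b by (intro inf2_greatest) (simp_all add: diff_below_iff)
  ultimately have "\<sim> b \<boxplus> \<sim> b \<preceq> \<sim> b"
    using b by (simp add: diff_below_iff)
  then show ?thesis using b by (auto simp: idems_def intro: below_antisym)
qed

text \<open>Subtracting a sum means subtracting twice, and
  \<open>b \<ominus> (b \<ominus> y)\<close> is \<open>y\<close>. The left-hand side uses only
  complements relative to \<open>b\<close>, so the difference can be recovered inside the
  interval.\<close>

lemma diff_via_complement: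
  assumes "x \<in> carrier N" "y \<in> carrier N" "b \<in> carrier N" "y \<preceq> b"
  shows "b \<ominus> ((b \<ominus> y) \<boxplus> x) = y \<ominus> x"
  using assms by (simp add: diff_add diff_diff_cancel)

text \<open>The left-hand side is the product of \<open>x\<close> and \<open>y\<close> computed in the interval below \<open>b\<close>.\<close>
lemma product_via_complement:
  assumes "x \<in> carrier N" "y \<in> carrier N" "b \<in> idems N" "x \<preceq> b" "y \<preceq> b"
  shows "b \<ominus> ((b \<ominus> x) \<boxplus> (b \<ominus> y)) = x \<odot> y"
proof -
  have b: "b \<in> carrier N" using assms idems_closed by simp
  \<comment> \<open>As \<open>\<sim> b\<close> is idempotent and lies below \<open>\<sim> x\<close>,
    it is absorbed; thus subtracting \<open>b \<ominus> y\<close> from \<open>x\<close> has the same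
    effect as subtracting \<open>\<sim> y\<close>.\<close>
  have "\<sim> x \<boxplus> \<sim> b = \<sim> x"
    using assms b by (simp add: idem_add_absorb' idem_neg neg_below_iff)
  then have "x \<ominus> (b \<ominus> y) = x \<ominus> \<sim> (b \<ominus> (b \<ominus> y))"
    using assms b by (simp add: diff_def flip: add_assoc)
  also have "\<dots> = x \<odot> y"
    using assms b by (simp add: diff_diff_cancel diff_def[of x] prod2_def)
  finally show ?thesis using assms b by (simp add: diff_via_complement)
qed

end

section \<open>Intervals and ideals\<close>

context is_mv_algebra
begin

text \<open>By residuation \<open>b \<ominus> x\<close> is the least \<open>z\<close> with
  \<open>b \<preceq> x \<boxplus> z\<close>. Adding \<open>a\<close> lifts it into the interval, and
  minimality survives because elements above the idempotent \<open>a\<close> absorb it. This is the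
  formula for the minimum that defines \<open>lam\<close>.\<close>

lemma rel_complement:
  assumes a: "a \<in> idems N" and b: "b \<in> idems N" and x: "x \<in> carrier N" "a \<preceq> x" "x \<preceq> b"
  shows "(b \<ominus> x) \<boxplus> a \<in> carrier N" "a \<preceq> (b \<ominus> x) \<boxplus> a" "(b \<ominus> x) \<boxplus> a \<preceq> b"
    and "x \<boxplus> ((b \<ominus> x) \<boxplus> a) = b"
    and "\<lbrakk>z \<in> carrier N; a \<preceq> z; x \<boxplus> z = b\<rbrakk> \<Longrightarrow> (b \<ominus> x) \<boxplus> a \<preceq> z"
proof -
  have c: "a \<in> carrier N" "b \<in> carrier N" "a \<boxplus> a = a" "b \<boxplus> b = b" "a \<preceq> b"
    using a b x below_trans[of a x b] by (auto simp: idems_def)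
  show "(b \<ominus> x) \<boxplus> a \<in> carrier N" "a \<preceq> (b \<ominus> x) \<boxplus> a"
    using c x by simp_all
  show "(b \<ominus> x) \<boxplus> a \<preceq> b"
    using c x add_mono[of "b \<ominus> x" b a b] by simp
  have "x \<boxplus> ((b \<ominus> x) \<boxplus> a) = b \<boxplus> a"
    using c x by (simp add: add_diff_cancel flip: add_assoc)
  also have "\<dots> = b"
    using a b c by (simp add: idem_add_absorb add_comm)
  finally show "x \<boxplus> ((b \<ominus> x) \<boxplus> a) = b" .
  assume z: "z \<in> carrier N" "a \<preceq> z" "x \<boxplus> z = b"
  then have "b \<ominus> x \<preceq> z"
    using c x by (simp add: diff_below_iff)
  then have "(b \<ominus> x) \<boxplus> a \<preceq> z \<boxplus> a"
    using c x z by (simp add: add_mono)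
  then show "(b \<ominus> x) \<boxplus> a \<preceq> z"
    using a z by (simp add: idem_add_absorb')
qed

text \<open>The algebra is given by its operations, with the negation specified on the carrier only,
  so that the lemma applies to \<open>interval_mv\<close>, whose negation is defined as a
  minimum.\<close>

lemma interval_is_mv_algebra:
  assumes a: "a \<in> idems N" and b: "b \<in> idems N" and ab: "a \<preceq> b"
    and A: "carrier A = {x \<in> carrier N. a \<preceq> x \<and> x \<preceq> b}" "oplus A = oplus N" "ozero A = a" "mv_one A = b"
    and nA: "\<And>x. x \<in> carrier A \<Longrightarrow> mv_neg A x = (b \<ominus> x) \<boxplus> a"
  shows "is_mv_algebra A"
proof -
  have c [simp]: "a \<in> carrier N" "b \<in> carrier N"
    using a b by (auto simp: idems_def)
  have bb: "b \<boxplus> b = b" using b by (auto simp: idems_def)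
  have add: "x \<boxplus> y \<in> carrier A" if "x \<in> carrier A" "y \<in> carrier A" for x y
  proof -
    have "a \<preceq> x \<boxplus> y"
      using that A below_trans[of a x "x \<boxplus> y"] by simp
    moreover have "x \<boxplus> y \<preceq> b"
      using that A bb add_mono[of x b y b] by simp
    ultimately show ?thesis using that A by simp
  qed
  have compl: "(b \<ominus> x) \<boxplus> a \<in> carrier A" if "x \<in> carrier A" for x
    using rel_complement[OF a b, of x] that A by simp
  \<comment> \<open>The Lukasiewicz term computed in the interval is the join of \<open>N\<close>:
    the \<open>a\<close> is absorbed by \<open>x\<close> and the complements relative to
    \<open>b\<close> combine to \<open>y \<ominus> x\<close>. Symmetry of the join then gives the
    axiom.\<close>
  have sup: "x \<boxplus> ((b \<ominus> (x \<boxplus> ((b \<ominus> y) \<boxplus> a))) \<boxplus> a) = x \<curlyvee> y"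
    if "x \<in> carrier A" "y \<in> carrier A" for x y
  proof -
    have m: "x \<in> carrier N" "a \<preceq> x" "y \<in> carrier N" "y \<preceq> b"
      using that A by auto
    have xa: "x \<boxplus> a = x"
      using m a by (simp add: idem_add_absorb')
    have "x \<boxplus> ((b \<ominus> y) \<boxplus> a) = x \<boxplus> (b \<ominus> y)"
      using m xa by (metis add_assoc add_comm c diff_closed)
    moreover have "b \<ominus> (x \<boxplus> (b \<ominus> y)) = y \<ominus> x"
      using m diff_via_complement[of x y b] by (simp add: add_comm)
    ultimately have "x \<boxplus> ((b \<ominus> (x \<boxplus> ((b \<ominus> y) \<boxplus> a))) \<boxplus> a) = x \<boxplus> a \<boxplus> (y \<ominus> x)"
      using m by (simp add: add_ac)
    then show ?thesis
      using m xa by (simp add: sup2_def)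
  qed
  have one: "x \<boxplus> b = b" if "x \<in> carrier A" for x
    using that b A by (simp add: idem_add_absorb)
  show ?thesis
  proof (rule is_mv_algebra.intro)
    show "comm_monoid (oplus_monoid A)"
      by (rule comm_monoidI)
        (use add ab in \<open>auto simp: oplus_monoid_def A add_ac idem_add_absorb'[OF a]\<close>)
    show "mv_neg A (ozero A) = mv_one A"
      using ab A by (simp add: nA add_comm add_diff_cancel)
    show "mv_neg A x \<in> carrier A" if "x \<in> carrier A" for x
      using that by (simp add: nA compl)
    show "mv_one A \<in> carrier A"
      using ab by (simp add: A)
    show "mv_neg A (mv_neg A x) = x" if x: "x \<in> carrier A" for x
    proof -
      have m: "x \<in> carrier N" "a \<preceq> x" "x \<preceq> b"
        using x A by auto
      have "b \<ominus> ((b \<ominus> x) \<boxplus> a) = x \<ominus> a"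
        using m by (simp add: diff_via_complement)
      then show ?thesis
        using m x by (simp add: nA compl) (simp add: add_comm add_diff_cancel)
    qed
    show "x \<oplus>\<^bsub>A\<^esub> mv_one A = mv_one A" if "x \<in> carrier A" for x
      using one[OF that] by (simp add: A)
    show "x \<oplus>\<^bsub>A\<^esub> mv_neg A (x \<oplus>\<^bsub>A\<^esub> mv_neg A y) = y \<oplus>\<^bsub>A\<^esub> mv_neg A (y \<oplus>\<^bsub>A\<^esub> mv_neg A x)"
      if "x \<in> carrier A" "y \<in> carrier A" for x y
    proof -
      have "x \<curlyvee> y = y \<curlyvee> x"
        using that A by (simp add: sup2_def add_diff_comm)
      then show ?thesis
        using that add sup[of x y] sup[of y x] compl by (simp add: nA A(2))
    qed
  qed
qed

end

section \<open>Order of a distributive lattice\<close>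

context is_distrib_lattice
begin

abbreviation emv_le (infix "\<preceq>" 50) where "x \<preceq> y \<equiv> x \<sqsubseteq>\<^bsub>emv_order M\<^esub> y"

lemma carrier_emv_order [simp]: "carrier (emv_order M) = carrier M"
  by (simp add: emv_order_def)

lemma le_iff_meet: "x \<preceq> y \<longleftrightarrow> emv_meet M x y = x"
  by (simp add: emv_order_def)

lemma meet_idem [simp]: "x \<in> carrier M \<Longrightarrow> emv_meet M x x = x"
  by (metis join_absorb meet_absorb meet_closed)

lemma le_refl [simp]: "x \<in> carrier M \<Longrightarrow> x \<preceq> x"
  by (simp add: le_iff_meet)

lemma le_antisym: "\<lbrakk>x \<preceq> y; y \<preceq> x; x \<in> carrier M; y \<in> carrier M\<rbrakk> \<Longrightarrow> x = y"
  by (metis le_iff_meet meet_comm)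

lemma le_trans: "\<lbrakk>x \<preceq> y; y \<preceq> z; x \<in> carrier M; y \<in> carrier M; z \<in> carrier M\<rbrakk> \<Longrightarrow> x \<preceq> z"
  by (metis le_iff_meet meet_assoc)

lemma partial_order_emv_order: "partial_order (emv_order M)"
proof -
  have eq: "(.=\<^bsub>emv_order M\<^esub>) = (=)"
    by (simp add: emv_order_def)
  show ?thesis
    by unfold_locales (auto simp: eq intro: le_antisym le_trans)
qed

lemma meet_lower:
  assumes "x \<in> carrier M" "y \<in> carrier M" shows "emv_meet M x y \<preceq> x" "emv_meet M x y \<preceq> y"
  using assms by (metis le_iff_meet meet_assoc meet_comm meet_closed meet_idem)+

lemma meet_greatest:
  "\<lbrakk>z \<preceq> x; z \<preceq> y; x \<in> carrier M; y \<in> carrier M; z \<in> carrier M\<rbrakk> \<Longrightarrow> z \<preceq> emv_meet M x y"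
  by (simp add: le_iff_meet flip: meet_assoc)

lemma le_iff_join:
  assumes "x \<in> carrier M" "y \<in> carrier M" shows "x \<preceq> y \<longleftrightarrow> emv_join M x y = y"
  using assms by (metis join_absorb join_comm le_iff_meet meet_absorb meet_comm)

lemma join_upper:
  assumes "x \<in> carrier M" "y \<in> carrier M" shows "x \<preceq> emv_join M x y" "y \<preceq> emv_join M x y"
  using assms meet_absorb[of x y] meet_absorb[of y x] by (simp_all add: le_iff_meet join_comm)

lemma join_least:
  "\<lbrakk>x \<preceq> z; y \<preceq> z; x \<in> carrier M; y \<in> carrier M; z \<in> carrier M\<rbrakk> \<Longrightarrow> emv_join M x y \<preceq> z"
  by (simp add: le_iff_join join_closed join_assoc)

lemma lam_eqI: "least (emv_order M) z (lam_set M a b x) \<Longrightarrow> lam M a b x = z"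
  unfolding lam_def
  by (rule the_equality) (auto intro: partial_order.least_unique[OF partial_order_emv_order])

end

section \<open>The ideal of a couple as an EMV-algebra\<close>

locale couple = is_mv_algebra N for N :: "'a mv_alg" +
  fixes I :: "'a set"
  assumes couple: "pmv_couple N I"
begin

abbreviation "M \<equiv> ideal_emv N I"

lemma maximal: "mv_maximal_ideal N I"
  using couple by (simp add: pmv_couple_def)

lemma ideal: "mv_ideal N I" and ideal_proper: "I \<noteq> carrier N"
  using maximal by (simp_all add: mv_maximal_ideal_def mv_proper_ideal_def)

lemma ideal_closed [simp, intro]: "x \<in> I \<Longrightarrow> x \<in> carrier N"
  and ideal_nonempty: "I \<noteq> {}"
  and ideal_down: "\<lbrakk>y \<preceq> x; x \<in> I; y \<in> carrier N\<rbrakk> \<Longrightarrow> y \<in> I"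
  and ideal_add [simp, intro]: "\<lbrakk>x \<in> I; y \<in> I\<rbrakk> \<Longrightarrow> x \<boxplus> y \<in> I"
  using ideal unfolding mv_ideal_def by blast+

lemma zero_ideal [simp, intro]: "\<zero>\<^bsub>N\<^esub> \<in> I"
proof -
  obtain x where "x \<in> I" using ideal_nonempty by blast
  then show ?thesis using ideal_down[of "\<zero>\<^bsub>N\<^esub>" x] by simp
qed

lemma ideal_diff [simp, intro]: "\<lbrakk>x \<in> I; y \<in> carrier N\<rbrakk> \<Longrightarrow> x \<ominus> y \<in> I"
  by (rule ideal_down[of _ x]) auto

text \<open>Otherwise one, as the sum of the two, would lie in a proper ideal. Hence the elements of
  \<open>I\<close> and their complements form a disjoint union, which makes definitions by cases on
  it sound.\<close>

lemma neg_not_ideal: assumes "x \<in> I" shows "\<sim> x \<notin> I"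
proof
  assume "\<sim> x \<in> I"
  then have "\<one>\<^sub>N \<in> I" using assms ideal_add[of x "\<sim> x"] by simp
  then have "carrier N \<subseteq> I" using ideal_down[of _ "\<one>\<^sub>N"] by auto
  then show False using ideal_proper by blast
qed

lemma carrier_cases: assumes "x \<in> carrier N" obtains "x \<in> I" | y where "y \<in> I" "x = \<sim> y"
proof -
  have "x \<in> I \<union> mv_neg N ` I"
    using couple assms by (simp add: pmv_couple_def)
  then show thesis using that by blast
qed

lemma idem_above: assumes "x \<in> I" obtains a where "a \<in> I" "a \<in> idems N" "x \<preceq> a"
proof -
  have "\<forall>x \<in> I. \<exists>a \<in> I \<inter> idems N. x \<preceq> a"
    using couple by (simp add: pmv_couple_def)
  then show thesis using assms that by blast
qed

lemma idem_above2:
  assumes "x \<in> I" "y \<in> I" obtains a where "a \<in> I" "a \<in> idems N" "x \<preceq> a" "y \<preceq> a"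
proof -
  obtain a where a: "a \<in> I" "a \<in> idems N" "x \<boxplus> y \<preceq> a"
    using assms idem_above by blast
  moreover have "x \<preceq> a" "y \<preceq> a"
    using a assms below_trans[of x "x \<boxplus> y" a] below_trans[of y "x \<boxplus> y" a] by simp_all
  ultimately show thesis using that by blast
qed

lemma ideal_sup2 [simp]: "\<lbrakk>x \<in> I; y \<in> I\<rbrakk> \<Longrightarrow> x \<curlyvee> y \<in> I"
  by (simp add: sup2_def)

lemma ideal_inf2 [simp]: "\<lbrakk>x \<in> I; y \<in> carrier N\<rbrakk> \<Longrightarrow> x \<curlywedge> y \<in> I"
  by (simp add: inf2_def)

lemma ideal_emv_simps [simp]:
  "carrier M = I" "oplus M = oplus N" "ozero M = \<zero>\<^bsub>N\<^esub>"
  "\<lbrakk>x \<in> I; y \<in> I\<rbrakk> \<Longrightarrow> emv_join M x y = x \<curlyvee> y"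
  "\<lbrakk>x \<in> I; y \<in> I\<rbrakk> \<Longrightarrow> emv_meet M x y = x \<curlywedge> y"
  by (simp_all add: ideal_emv_def join_eq meet_eq)

lemma carrier_order_M [simp]: "carrier (emv_order M) = I"
  by (simp add: emv_order_def)

lemma le_M_iff [simp]: "\<lbrakk>x \<in> I; y \<in> I\<rbrakk> \<Longrightarrow> x \<sqsubseteq>\<^bsub>emv_order M\<^esub> y \<longleftrightarrow> x \<preceq> y"
  by (simp add: emv_order_def inf2_eq_iff)

lemma idems_M: "idems M = I \<inter> idems N"
  by (auto simp: idems_def)

lemma interval_M: "\<lbrakk>a \<in> I; b \<in> I\<rbrakk> \<Longrightarrow> \<lbrace>a..b\<rbrace>\<^bsub>emv_order M\<^esub> = {x \<in> carrier N. a \<preceq> x \<and> x \<preceq> b}"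
  using ideal_down[of _ b] by (auto simp: at_least_at_most_def)

lemma distrib_lattice_M: "is_distrib_lattice M"
proof (rule is_distrib_lattice.intro)
  fix x y z assume m: "x \<in> carrier M" "y \<in> carrier M" "z \<in> carrier M"
  then have m' [simp]: "x \<in> I" "y \<in> I" "z \<in> I" by simp_all
  show "emv_meet M x (emv_join M y z) = emv_join M (emv_meet M x y) (emv_meet M x z)"
    by (simp add: inf2_sup2_distrib)
  show "emv_join M (emv_join M x y) z = emv_join M x (emv_join M y z)"
    by (simp add: sup2_assoc)
  show "emv_meet M (emv_meet M x y) z = emv_meet M x (emv_meet M y z)"
    by (simp add: inf2_assoc)
next
  fix x y assume m: "x \<in> carrier M" "y \<in> carrier M"
  then have m' [simp]: "x \<in> I" "y \<in> I" by simp_all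
  show "emv_join M x y \<in> carrier M" "emv_meet M x y \<in> carrier M"
    by simp_all
  show "emv_join M x y = emv_join M y x"
    by (simp add: sup2_def add_diff_comm)
  show "emv_meet M x y = emv_meet M y x"
    by (simp add: inf2_comm)
  show "emv_join M x (emv_meet M x y) = x"
    by (simp add: sup2_absorb)
  show "emv_meet M x (emv_join M x y) = x"
    by (simp add: inf2_eq_iff)
qed

text \<open>The content is \<open>rel_complement\<close>; what remains is that the interval, formed
  in \<open>M\<close>, is the one formed in \<open>N\<close>, by down-closure of
  \<open>I\<close>.\<close>

lemma least_lam_set:
  assumes "a \<in> I" "a \<in> idems N" "b \<in> I" "b \<in> idems N" "x \<in> carrier N" "a \<preceq> x" "x \<preceq> b"
  shows "least (emv_order M) ((b \<ominus> x) \<boxplus> a) (lam_set M a b x)"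
proof -
  have c: "(b \<ominus> x) \<boxplus> a \<in> I"
    using assms rel_complement(1,3)[of a b x] ideal_down[of "(b \<ominus> x) \<boxplus> a" b] by blast
  have "lam_set M a b x \<subseteq> I"
    by (auto simp: lam_set_def at_least_at_most_def)
  moreover have "(b \<ominus> x) \<boxplus> a \<in> lam_set M a b x"
    using assms rel_complement(1-4)[of a b x] by (simp add: lam_set_def interval_M)
  moreover have "(b \<ominus> x) \<boxplus> a \<preceq> z" if "z \<in> lam_set M a b x" for z
    using that assms rel_complement(5)[of a b x z] by (simp add: lam_set_def interval_M)
  ultimately show ?thesis
    using c by (simp add: least_def subset_iff)
qed

lemma lam_M:
  assumes "a \<in> I" "a \<in> idems N" "b \<in> I" "b \<in> idems N" "x \<in> carrier N" "a \<preceq> x" "x \<preceq> b"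
  shows "lam M a b x = (b \<ominus> x) \<boxplus> a"
  using is_distrib_lattice.lam_eqI[OF distrib_lattice_M least_lam_set[OF assms]] .

lemma zero_idem [simp]: "\<zero>\<^bsub>N\<^esub> \<in> idems N"
  by (simp add: idems_def)

lemma lam_zero:
  assumes "b \<in> I" "b \<in> idems N" "x \<in> carrier N" "x \<preceq> b" shows "lam M \<zero>\<^bsub>N\<^esub> b x = b \<ominus> x"
  using assms lam_M[of "\<zero>\<^bsub>N\<^esub>" b x] by auto

lemma emv_algebra_M: "is_emv_algebra M"
proof -
  interpret M: is_distrib_lattice M by (rule distrib_lattice_M)
  show ?thesis
  proof (intro is_emv_algebra.intro is_emv_algebra_axioms.intro distrib_lattice_M)
    show "least (emv_order M) (ozero M) (carrier M)"
      by (auto simp: least_def)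
    show "comm_monoid (oplus_monoid M)"
      by (rule comm_monoidI) (auto simp: oplus_monoid_def add_ac)
    show "x \<oplus>\<^bsub>M\<^esub> z \<sqsubseteq>\<^bsub>emv_order M\<^esub> y \<oplus>\<^bsub>M\<^esub> z"
      if "x \<in> carrier M" "y \<in> carrier M" "z \<in> carrier M" "x \<sqsubseteq>\<^bsub>emv_order M\<^esub> y" for x y z
      using that by (simp add: add_mono)
    show "\<exists>a \<in> idems M. x \<sqsubseteq>\<^bsub>emv_order M\<^esub> a" if "x \<in> carrier M" for x
      using idem_above[of x] that by (metis IntI idems_M ideal_emv_simps(1) le_M_iff)
    show "\<exists>z. least (emv_order M) z (lam_set M a b x)"
      if "a \<in> idems M" "b \<in> idems M" "x \<in> \<lbrace>a..b\<rbrace>\<^bsub>emv_order M\<^esub>" for a b x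
      using that least_lam_set[of a b x] by (auto simp: idems_M interval_M)
    show "is_mv_algebra (interval_mv M a b)"
      if "a \<in> idems M" "b \<in> idems M" "a \<sqsubseteq>\<^bsub>emv_order M\<^esub> b" for a b
      by (rule interval_is_mv_algebra[of a b])
        (use that in \<open>auto simp: interval_mv_def idems_M interval_M lam_M\<close>)
  qed
qed

lemma proper_iff: "is_proper_emv M \<longleftrightarrow> \<not> (\<exists>g. greatest (mv_order N) g I)"
proof -
  have "greatest (emv_order M) g (carrier M) \<longleftrightarrow> greatest (mv_order N) g I" for g
    by (auto simp: greatest_def)
  then show ?thesis by (simp add: is_proper_emv_def emv_algebra_M)
qed

end

section \<open>The two categories\<close>

context is_emv_algebra
begin

lemma zero_closed [simp, intro]: "ozero M \<in> carrier M"
  and zero_le [simp]: "x \<in> carrier M \<Longrightarrow> ozero M \<preceq> x"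
  using zero_least by (auto simp: least_def)

lemma add_closed [simp, intro]: "\<lbrakk>x \<in> carrier M; y \<in> carrier M\<rbrakk> \<Longrightarrow> x \<oplus>\<^bsub>M\<^esub> y \<in> carrier M"
  using comm_monoid.axioms(1)[OF oplus_comm_monoid, THEN monoid.m_closed]
  by (simp add: oplus_monoid_def)

lemma add_comm: "\<lbrakk>x \<in> carrier M; y \<in> carrier M\<rbrakk> \<Longrightarrow> x \<oplus>\<^bsub>M\<^esub> y = y \<oplus>\<^bsub>M\<^esub> x"
  using comm_monoid.m_comm[OF oplus_comm_monoid] by (simp add: oplus_monoid_def)

lemma add_assoc:
  "\<lbrakk>x \<in> carrier M; y \<in> carrier M; z \<in> carrier M\<rbrakk>
    \<Longrightarrow> (x \<oplus>\<^bsub>M\<^esub> y) \<oplus>\<^bsub>M\<^esub> z = x \<oplus>\<^bsub>M\<^esub> (y \<oplus>\<^bsub>M\<^esub> z)"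
  using comm_monoid.axioms(1)[OF oplus_comm_monoid, THEN monoid.m_assoc]
  by (simp add: oplus_monoid_def)

lemma add_zero [simp]: "x \<in> carrier M \<Longrightarrow> x \<oplus>\<^bsub>M\<^esub> ozero M = x"
  using comm_monoid.axioms(1)[OF oplus_comm_monoid, THEN monoid.r_one]
  by (simp add: oplus_monoid_def)

lemma idems_closed: "b \<in> idems M \<Longrightarrow> b \<in> carrier M"
  by (simp add: idems_def)

lemma zero_idem [simp]: "ozero M \<in> idems M"
  by (simp add: idems_def)

lemma idem_add: "\<lbrakk>a \<in> idems M; b \<in> idems M\<rbrakk> \<Longrightarrow> a \<oplus>\<^bsub>M\<^esub> b \<in> idems M"
  unfolding idems_def by (smt (verit) add_assoc add_closed add_comm mem_Collect_eq)

lemma le_add: "\<lbrakk>x \<in> carrier M; y \<in> carrier M\<rbrakk> \<Longrightarrow> x \<preceq> x \<oplus>\<^bsub>M\<^esub> y"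
  using oplus_mono[of "ozero M" y x] by (simp add: add_comm[of _ x])

lemma least_lam:
  assumes "b \<in> idems M" "x \<in> carrier M" "x \<preceq> b"
  shows "least (emv_order M) (lam M (ozero M) b x) (lam_set M (ozero M) b x)"
proof -
  obtain z where "least (emv_order M) z (lam_set M (ozero M) b x)"
    using lam_exists[of "ozero M" b x] assms by (auto simp: idems_closed at_least_at_most_def)
  then show ?thesis
    using lam_eqI by simp
qed

lemma lam_props:
  assumes "b \<in> idems M" "x \<in> carrier M" "x \<preceq> b"
  shows "lam M (ozero M) b x \<in> carrier M" "lam M (ozero M) b x \<preceq> b"
    and "x \<oplus>\<^bsub>M\<^esub> lam M (ozero M) b x = b"
    and "\<lbrakk>z \<in> carrier M; z \<preceq> b; x \<oplus>\<^bsub>M\<^esub> z = b\<rbrakk> \<Longrightarrow> lam M (ozero M) b x \<preceq> z"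
  using least_lam[OF assms] by (auto simp: least_def lam_set_def at_least_at_most_def)

lemma lam_eq_if_least:
  assumes "b \<in> idems M" "x \<in> carrier M" "x \<preceq> b"
    and "c \<in> carrier M" "c \<preceq> b" "x \<oplus>\<^bsub>M\<^esub> c = b"
    and "\<And>z. \<lbrakk>z \<in> carrier M; z \<preceq> b; x \<oplus>\<^bsub>M\<^esub> z = b\<rbrakk> \<Longrightarrow> c \<preceq> z"
  shows "lam M (ozero M) b x = c"
  using lam_props[OF assms(1-3)] assms by (metis le_antisym)

end

section \<open>Homomorphisms and their composites\<close>

lemma mv_homD:
  assumes "f \<in> mv_hom N N'"
  shows "x \<in> carrier N \<Longrightarrow> f x \<in> carrier N'"
    and "\<lbrakk>x \<in> carrier N; y \<in> carrier N\<rbrakk> \<Longrightarrow> f (x \<oplus>\<^bsub>N\<^esub> y) = f x \<oplus>\<^bsub>N'\<^esub> f y"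
    and "x \<in> carrier N \<Longrightarrow> f (mv_neg N x) = mv_neg N' (f x)"
    and "f (ozero N) = ozero N'" "f (mv_one N) = mv_one N'" "f \<in> extensional (carrier N)"
  using assms by (auto simp: mv_hom_def PiE_def)

lemma emv_homD:
  assumes "f \<in> emv_hom M M'"
  shows "x \<in> carrier M \<Longrightarrow> f x \<in> carrier M'"
    and "\<lbrakk>x \<in> carrier M; y \<in> carrier M\<rbrakk> \<Longrightarrow> f (emv_join M x y) = emv_join M' (f x) (f y)"
    and "\<lbrakk>x \<in> carrier M; y \<in> carrier M\<rbrakk> \<Longrightarrow> f (emv_meet M x y) = emv_meet M' (f x) (f y)"
    and "\<lbrakk>x \<in> carrier M; y \<in> carrier M\<rbrakk> \<Longrightarrow> f (x \<oplus>\<^bsub>M\<^esub> y) = f x \<oplus>\<^bsub>M'\<^esub> f y"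
    and "f (ozero M) = ozero M'"
    and "\<lbrakk>b \<in> idems M; x \<in> \<lbrace>ozero M..b\<rbrace>\<^bsub>emv_order M\<^esub>\<rbrakk>
      \<Longrightarrow> f (lam M (ozero M) b x) = lam M' (ozero M') (f b) (f x)"
    and "f \<in> extensional (carrier M)"
  using assms by (auto simp: emv_hom_def PiE_def)

lemma emv_hom_idems:
  assumes "f \<in> emv_hom M M'" "b \<in> idems M" shows "f b \<in> idems M'"
  using assms(2) by (simp add: idems_def emv_homD(1)[OF assms(1)] flip: emv_homD(4)[OF assms(1)])

text \<open>The order is expressed by meets, so it is preserved. For composites this is needed
  because compatibility with \<open>lam\<close> is demanded only on intervals.\<close>

lemma emv_hom_interval:
  assumes "f \<in> emv_hom M M'" "x \<in> \<lbrace>a..b\<rbrace>\<^bsub>emv_order M\<^esub>" "a \<in> carrier M" "b \<in> carrier M"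
  shows "f x \<in> \<lbrace>f a..f b\<rbrace>\<^bsub>emv_order M'\<^esub>"
  using assms emv_homD(1)[OF assms(1), of x] emv_homD(3)[OF assms(1), of a x] emv_homD(3)[OF assms(1), of x b]
  by (simp add: at_least_at_most_def emv_order_def)

lemma mv_hom_compose:
  assumes "f \<in> mv_hom N1 N2" "g \<in> mv_hom N2 N3" "is_mv_algebra N1"
  shows "compose (carrier N1) g f \<in> mv_hom N1 N3"
proof -
  interpret is_mv_algebra N1 by fact
  show ?thesis
    using mv_homD[OF assms(1)] mv_homD[OF assms(2)] by (simp add: mv_hom_def compose_def)
qed

lemma emv_hom_compose:
  assumes f: "f \<in> emv_hom M1 M2" and g: "g \<in> emv_hom M2 M3" and "is_emv_algebra M1"
  shows "compose (carrier M1) g f \<in> emv_hom M1 M3"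
proof -
  interpret is_emv_algebra M1 by fact
  have 1: "g (f (lam M1 (ozero M1) b x)) = lam M3 (ozero M3) (g (f b)) (g (f x))"
    if "b \<in> idems M1" "x \<in> \<lbrace>ozero M1..b\<rbrace>\<^bsub>emv_order M1\<^esub>" for b x
  proof -
    have "f x \<in> \<lbrace>ozero M2..f b\<rbrace>\<^bsub>emv_order M2\<^esub>"
      using emv_hom_interval[OF f that(2)] that emv_homD(5)[OF f] by (simp add: idems_def)
    then show ?thesis
      using that emv_homD(6)[OF f] emv_homD(6)[OF g] emv_hom_idems[OF f] by simp
  qed
  show ?thesis
    unfolding emv_hom_def
    using emv_homD(1-5)[OF f] emv_homD(1-5)[OF g] 1 lam_props(1)
    by (auto simp: compose_def join_closed meet_closed idems_closed at_least_at_most_def)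
qed

lemma emv_hom_ident:
  assumes "is_emv_algebra M" shows "(\<lambda>x \<in> carrier M. x) \<in> emv_hom M M"
proof -
  interpret is_emv_algebra M by fact
  show ?thesis
    using lam_props(1) unfolding emv_hom_def
    by (auto simp: join_closed meet_closed idems_closed at_least_at_most_def)
qed

lemma mv_hom_ident:
  assumes "is_mv_algebra N" shows "(\<lambda>x \<in> carrier N. x) \<in> mv_hom N N"
proof -
  interpret is_mv_algebra N by fact
  show ?thesis by (simp add: mv_hom_def)
qed

lemma hom_funcset: "f \<in> mv_hom N N' \<Longrightarrow> f \<in> carrier N \<rightarrow> carrier N'"
  by (auto simp: mv_hom_def)

lemma emv_hom_funcset: "f \<in> emv_hom M M' \<Longrightarrow> f \<in> carrier M \<rightarrow> carrier M'"
  by (auto simp: emv_hom_def)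

lemma pmv_coupleD: "pmv_couple N I \<Longrightarrow> is_mv_algebra N" "pmv_couple N I \<Longrightarrow> I \<subseteq> carrier N"
  by (auto simp: pmv_couple_def)

section \<open>Category laws\<close>

lemma PEMV_simps [simp]:
  "M \<in> Obj PEMV \<longleftrightarrow> is_proper_emv M" "Hom PEMV = emv_hom"
  "Ident PEMV M = (\<lambda>x \<in> carrier M. x)" "Comp PEMV M M' M'' g f = compose (carrier M) g f"
  by (simp_all add: PEMV_def)

lemma PMV_simps [simp]:
  "(N, I) \<in> Obj PMV \<longleftrightarrow> pmv_couple N I \<and> \<not> (\<exists>g. greatest (mv_order N) g I)"
  "\<phi> \<in> Hom PMV (N, I) (N', I') \<longleftrightarrow> \<phi> \<in> mv_hom N N' \<and> \<phi> ` I \<subseteq> I'"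
  "Ident PMV (N, I) = (\<lambda>x \<in> carrier N. x)"
  "Comp PMV (N, I) (N', I') (N'', I'') g f = compose (carrier N) g f"
  by (simp_all add: PMV_def)

lemma category_PEMV: "is_category PEMV"
proof (rule is_category.intro, goal_cases)
  case (1 X)
  then show ?case by (simp add: is_proper_emv_def emv_hom_ident)
next
  case (2 X Y Z f g)
  then show ?case by (simp add: is_proper_emv_def emv_hom_compose)
next
  case (3 X Y f)
  then show ?case by (simp add: compose_Id[OF emv_hom_funcset emv_homD(7)])
next
  case (4 X Y f)
  then show ?case by (simp add: Id_compose[OF emv_hom_funcset emv_homD(7)])
next
  case (5 W X Y Z f g h)
  then show ?case by (simp add: compose_assoc[OF emv_hom_funcset])
qed

lemma mv_hom_compose_ident:
  assumes "f \<in> mv_hom N N'"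
  shows "compose (carrier N) f (\<lambda>x \<in> carrier N. x) = f"
    and "compose (carrier N) (\<lambda>x \<in> carrier N'. x) f = f"
  using compose_Id[OF hom_funcset mv_homD(6)] Id_compose[OF hom_funcset mv_homD(6)] assms by blast+

lemma category_PMV: "is_category PMV"
proof (rule is_category.intro, goal_cases)
  case (1 X)
  obtain N I where X: "X = (N, I)" by (cases X)
  then show ?case
    using 1 pmv_coupleD[of N I] by (simp add: mv_hom_ident image_subset_iff subset_iff)
next
  case (2 X Y Z f g)
  obtain N I N' I' N'' I'' where *: "X = (N, I)" "Y = (N', I')" "Z = (N'', I'')"
    by (cases X, cases Y, cases Z)
  have I: "I \<subseteq> carrier N" and N: "is_mv_algebra N"
    using 2 * pmv_coupleD[of N I] by simp_all
  have "compose (carrier N) g f ` I \<subseteq> I''"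
    using 2(4,5) I unfolding * by (auto simp: compose_def image_subset_iff)
  then show ?case
    using 2(4,5) N mv_hom_compose[of f N N' g N''] unfolding * by simp
next
  case (3 X Y f)
  then show ?case
    by (cases X, cases Y) (clarsimp simp: mv_hom_compose_ident)
next
  case (4 X Y f)
  then show ?case
    by (cases X, cases Y) (clarsimp simp: mv_hom_compose_ident)
next
  case (5 W X Y Z f g h)
  obtain N I N' I' where *: "W = (N, I)" "X = (N', I')" by (cases W, cases X)
  show ?case
    using compose_assoc[of f "carrier N" "carrier N'" h g] 5(5) hom_funcset[of f N N'] unfolding *
    by (cases Y, cases Z) simp
qed

section \<open>Extension of homomorphisms\<close>

lemma Phi_simps [simp]:
  "on_obj Phi (N, I) = ideal_emv N I" "on_mor Phi (N, I) (N', I') \<phi> = restrict \<phi> I"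
  by (simp_all add: Phi_def)

lemma couple_iff: "couple N I \<longleftrightarrow> pmv_couple N I"
  by (auto simp: couple_def couple_axioms_def pmv_couple_def)

text \<open>Joins and meets are terms in the difference, and \<open>lam\<close> below an idempotent
  \<open>b\<close> is \<open>b \<ominus> x\<close>, so everything reduces to the fact that
  \<open>f\<close> commutes with differences.\<close>

lemma mv_hom_restrict:
  assumes "couple N I" "couple N' I'" and f: "f \<in> mv_hom N N'" and fI: "f ` I \<subseteq> I'"
  shows "restrict f I \<in> emv_hom (ideal_emv N I) (ideal_emv N' I')"
proof -
  interpret A: couple N I by fact
  interpret B: couple N' I' by fact
  note f' = mv_homD[OF f]
  have I: "f x \<in> I'" if "x \<in> I" for x using fI that by blast
  have diff: "f (A.diff x y) = B.diff (f x) (f y)" if "x \<in> carrier N" "y \<in> carrier N" for x y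
    using that by (simp add: A.diff_def B.diff_def f')
  have sup: "f (A.sup2 x y) = B.sup2 (f x) (f y)" if "x \<in> carrier N" "y \<in> carrier N" for x y
    using that by (simp add: A.sup2_def B.sup2_def f' diff)
  have inf: "f (A.inf2 x y) = B.inf2 (f x) (f y)" if "x \<in> carrier N" "y \<in> carrier N" for x y
    using that by (simp add: A.inf2_def B.inf2_def diff)
  have le: "f x \<sqsubseteq>\<^bsub>mv_order N'\<^esub> f y" if "x \<sqsubseteq>\<^bsub>mv_order N\<^esub> y" "x \<in> carrier N" "y \<in> carrier N" for x y
    using that f'(2)[of "mv_neg N x" y] by (simp add: A.below_iff B.below_iff f')
  have idem: "f b \<in> idems N'" if "b \<in> idems N" for b
    using that f'(1) by (simp add: idems_def flip: f'(2))
  have lam: "f (lam A.M (ozero N) b x) = lam B.M (ozero N') (f b) (f x)" "lam A.M (ozero N) b x \<in> I"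
    if b: "b \<in> I" "b \<in> idems N" and x: "x \<in> carrier N" "x \<sqsubseteq>\<^bsub>mv_order N\<^esub> b" for b x
  proof -
    have "lam B.M (ozero N') (f b) (f x) = B.diff (f b) (f x)"
      using b x by (intro B.lam_zero) (auto simp: I idem le f')
    then show "f (lam A.M (ozero N) b x) = lam B.M (ozero N') (f b) (f x)" "lam A.M (ozero N) b x \<in> I"
      using b x by (simp_all add: A.lam_zero diff)
  qed
  have "restrict f I (lam A.M (ozero N) b x) = lam B.M (ozero N') (restrict f I b) (restrict f I x)"
    if "b \<in> I" "b \<in> idems N" "x \<in> carrier N" "x \<sqsubseteq>\<^bsub>mv_order N\<^esub> b" for b x
    using that lam[OF that] A.ideal_down[OF that(4,1,3)] by simp
  moreover have "restrict f I \<in> I \<rightarrow>\<^sub>E I'"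
    using I by simp
  ultimately show ?thesis
    unfolding emv_hom_def using sup inf
    by (simp add: A.idems_M A.interval_M I f' del: restrict_apply) (simp add: I f')
qed

lemma Phi_functor: "is_functor PMV PEMV Phi"
proof (rule is_functor.intro[OF category_PMV category_PEMV], rule is_functor_axioms.intro, goal_cases)
  case (1 X)
  obtain N I where X: "X = (N, I)" by (cases X)
  then interpret couple N I using 1 by (simp add: couple_iff)
  show ?case using 1 X proper_iff by simp
next
  case (2 X Y f)
  obtain N I N' I' where *: "X = (N, I)" "Y = (N', I')" by (cases X, cases Y)
  show ?case
    using 2 mv_hom_restrict[of N I N' I' f] unfolding * by (simp add: couple_iff)
next
  case (3 X)
  obtain N I where X: "X = (N, I)" by (cases X)
  then interpret couple N I using 3 by (simp add: couple_iff)
  show ?case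
    unfolding X by (simp add: restrict_def fun_eq_iff)
next
  case (4 X Y Z f g)
  obtain N I N' I' N'' I'' where *: "X = (N, I)" "Y = (N', I')" "Z = (N'', I'')"
    by (cases X, cases Y, cases Z)
  then interpret couple N I using 4 by (simp add: couple_iff)
  have "f ` I \<subseteq> I'" using 4 unfolding * by simp
  then show ?case
    unfolding * by (auto simp: restrict_def compose_def fun_eq_iff)
qed

text \<open>A priori \<open>h\<close> respects only complements relative to idempotents of the
  ideal. Below a common idempotent \<open>b\<close>, difference and product are expressions in such
  complements; \<open>h\<close> turns them into the same expressions relative to \<open>h b\<close>,
  which is again idempotent.\<close>

lemma emv_hom_ideal_props:
  assumes "couple N I" "couple N' I'" and h: "h \<in> emv_hom (ideal_emv N I) (ideal_emv N' I')"
    and x: "x \<in> I" and y: "y \<in> I"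
  shows "h (is_mv_algebra.diff N x y) = is_mv_algebra.diff N' (h x) (h y)"
    and "h (is_mv_algebra.prod2 N x y) = is_mv_algebra.prod2 N' (h x) (h y)"
    and "is_mv_algebra.prod2 N x y \<in> I"
proof -
  interpret A: couple N I by fact
  interpret B: couple N' I' by fact
  note h' = emv_homD[OF h, simplified]
  obtain b where b: "b \<in> I" "b \<in> idems N" "x \<sqsubseteq>\<^bsub>mv_order N\<^esub> b" "y \<sqsubseteq>\<^bsub>mv_order N\<^esub> b"
    using A.idem_above2[OF x y] .
  have hb: "h b \<in> I'" "h b \<in> idems N'"
    using emv_hom_idems[OF h, of b] b by (auto simp: A.idems_M B.idems_M)
  have le: "h u \<sqsubseteq>\<^bsub>mv_order N'\<^esub> h v" if "u \<sqsubseteq>\<^bsub>mv_order N\<^esub> v" "u \<in> I" "v \<in> I" for u v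
    using that h'(3)[of u v] by (simp add: h'(1) A.inf2_eq_iff[symmetric] flip: B.inf2_eq_iff)
  have compl: "h (A.diff b u) = B.diff (h b) (h u)" if u: "u \<in> I" "u \<sqsubseteq>\<^bsub>mv_order N\<^esub> b" for u
  proof -
    have "h (lam A.M (ozero N) b u) = lam B.M (ozero N') (h b) (h u)"
      using h'(6)[of b u] b u by (simp add: A.idems_M A.interval_M)
    then show ?thesis
      using b u hb by (simp add: A.lam_zero B.lam_zero le h')
  qed
  have below_b: "u \<oplus>\<^bsub>N\<^esub> v \<sqsubseteq>\<^bsub>mv_order N\<^esub> b" 
    if "u \<in> I" "u \<sqsubseteq>\<^bsub>mv_order N\<^esub> b" "v \<in> I" "v \<sqsubseteq>\<^bsub>mv_order N\<^esub> b" for u v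
    using that b A.add_mono[of u b v b] by (simp add: idems_def)
  have "A.diff x y = A.diff b (A.diff b x \<oplus>\<^bsub>N\<^esub> y)"
    using b x y by (simp add: A.diff_via_complement)
  also have "h \<dots> = B.diff (h b) (B.diff (h b) (h x) \<oplus>\<^bsub>N'\<^esub> h y)"
    using b x y by (simp add: compl below_b h')
  also have "\<dots> = B.diff (h x) (h y)"
    using b x y hb by (simp add: B.diff_via_complement le h')
  finally show "h (A.diff x y) = B.diff (h x) (h y)" .
  have eq: "A.diff b (A.diff b x \<oplus>\<^bsub>N\<^esub> A.diff b y) = A.prod2 x y"
    using b x y by (simp add: A.product_via_complement)
  show "A.prod2 x y \<in> I"
    using b x y by (simp flip: eq)
  have "h (A.prod2 x y) = B.diff (h b) (B.diff (h b) (h x) \<oplus>\<^bsub>N'\<^esub> B.diff (h b) (h y))"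
    using b x y by (simp add: compl below_b h' flip: eq)
  also have "\<dots> = B.prod2 (h x) (h y)"
    using b x y hb by (simp add: B.product_via_complement le h')
  finally show "h (A.prod2 x y) = B.prod2 (h x) (h y)" .
qed

text \<open>The only candidate for an extension of \<open>h\<close> to \<open>N\<close>, which is the disjoint union of \<open>I\<close> and
  its set of complements.\<close>
definition extend_hom :: "'a mv_alg \<Rightarrow> 'a set \<Rightarrow> 'b mv_alg \<Rightarrow> ('a \<Rightarrow> 'b) \<Rightarrow> 'a \<Rightarrow> 'b" where
  "extend_hom N I N' h =
     (\<lambda>x \<in> carrier N. if x \<in> I then h x else mv_neg N' (h (mv_neg N x)))"

text \<open>A sum with a complemented summand is the complement of a difference or a product in
  \<open>I\<close>. Additivity therefore splits into four cases, all settled by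
  \<open>emv_hom_ideal_props\<close> and additivity of \<open>h\<close>.\<close>

lemma extend_hom_is_hom:
  assumes "couple N I" "couple N' I'" and h: "h \<in> emv_hom (ideal_emv N I) (ideal_emv N' I')"
  shows "extend_hom N I N' h \<in> mv_hom N N'" and "restrict (extend_hom N I N' h) I = h"
proof -
  interpret A: couple N I by fact
  interpret B: couple N' I' by fact
  note h' = emv_homD[OF h, simplified]
  note hd = emv_hom_ideal_props[OF assms]
  let ?f = "extend_hom N I N' h"
  have f_I: "?f x = h x" if "x \<in> I" for x
    using that by (simp add: extend_hom_def)
  have f_neg: "?f (mv_neg N x) = mv_neg N' (h x)" if "x \<in> I" for x
    using that A.neg_not_ideal[of x] by (simp add: extend_hom_def)
  have add: "?f (x \<oplus>\<^bsub>N\<^esub> y) = ?f x \<oplus>\<^bsub>N'\<^esub> ?f y" if xy: "x \<in> carrier N" "y \<in> carrier N" for x y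
    using xy(1)
  proof (cases rule: A.carrier_cases)
    case x: 1
    show ?thesis using xy(2)
    proof (cases rule: A.carrier_cases)
      case 1
      then show ?thesis using x by (simp add: f_I h')
    next
      case (2 z)
      then show ?thesis
        using x by (simp add: A.add_neg_right B.add_neg_right f_I f_neg hd h')
    qed
  next
    case x: (2 w)
    show ?thesis using xy(2)
    proof (cases rule: A.carrier_cases)
      case 1
      then show ?thesis
        using x by (simp add: A.add_neg_left B.add_neg_left f_I f_neg hd h')
    next
      case (2 z)
      then show ?thesis
        using x by (simp add: A.add_neg_neg B.add_neg_neg f_neg hd h')
    qed
  qed
  have neg: "?f (mv_neg N x) = mv_neg N' (?f x)" if "x \<in> carrier N" for x
    using that by (cases rule: A.carrier_cases) (simp_all add: f_I f_neg h')
  have closed: "?f x \<in> carrier N'" if "x \<in> carrier N" for x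
    using that by (cases rule: A.carrier_cases) (simp_all add: f_I f_neg h')
  have zero: "?f (ozero N) = ozero N'"
    by (simp add: f_I h')
  have "?f (mv_one N) = mv_one N'"
    using neg[of "ozero N"] zero by simp
  moreover have "?f \<in> carrier N \<rightarrow>\<^sub>E carrier N'"
    using closed by (simp add: PiE_def) (simp add: extend_hom_def)
  ultimately show "?f \<in> mv_hom N N'"
    using add neg zero by (simp add: mv_hom_def)
  show "restrict ?f I = h"
    by (rule extensionalityI[of _ I]) (use h'(7) f_I in simp_all)
qed

text \<open>Outside \<open>I\<close> every element is a complement of one in \<open>I\<close>, and
  \<open>f\<close> commutes with complements, so its values there are forced.\<close>

lemma hom_eq_extend_hom:
  assumes "couple N I" and f: "f \<in> mv_hom N N'"
  shows "f = extend_hom N I N' (restrict f I)"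
proof (rule extensionalityI[of _ "carrier N"])
  interpret couple N I by fact
  fix x assume "x \<in> carrier N"
  then show "f x = extend_hom N I N' (restrict f I) x"
    by (cases rule: carrier_cases)
      (use neg_not_ideal in \<open>auto simp: extend_hom_def mv_homD(3)[OF f]\<close>)
qed (simp_all add: extend_hom_def mv_homD(6)[OF f])

lemma extend_hom_unique:
  assumes "couple N I" "couple N' I'" and h: "h \<in> emv_hom (ideal_emv N I) (ideal_emv N' I')"
  shows "\<exists>!f. (f \<in> mv_hom N N' \<and> f ` I \<subseteq> I') \<and> h = restrict f I"
proof (rule ex1I[of _ "extend_hom N I N' h"])
  interpret A: couple N I by fact
  interpret B: couple N' I' by fact
  have "extend_hom N I N' h x \<in> I'" if "x \<in> I" for x
    using fun_cong[OF extend_hom_is_hom(2)[OF assms], of x] emv_homD(1)[OF h, of x] that by simp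
  then show "(extend_hom N I N' h \<in> mv_hom N N' \<and> extend_hom N I N' h ` I \<subseteq> I') \<and>
      h = restrict (extend_hom N I N' h) I"
    using extend_hom_is_hom[OF assms] by auto
  show "f = extend_hom N I N' h" if "(f \<in> mv_hom N N' \<and> f ` I \<subseteq> I') \<and> h = restrict f I" for f
    using hom_eq_extend_hom[OF assms(1), of f N'] that by blast
qed

section \<open>Surjectivity and injectivity of the extension\<close>

lemma hom_surj_if_surj_on_ideal:
  assumes "couple N I" "couple N' I'" and f: "f \<in> mv_hom N N'" and s: "f ` I = I'"
  shows "f ` carrier N = carrier N'"
proof
  interpret A: couple N I by fact
  interpret B: couple N' I' by fact
  show "f ` carrier N \<subseteq> carrier N'"
    using mv_homD(1)[OF f] by blast
  show "carrier N' \<subseteq> f ` carrier N"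
  proof
    fix y assume "y \<in> carrier N'"
    then show "y \<in> f ` carrier N"
    proof (cases rule: B.carrier_cases)
      case 1
      then show ?thesis using s by auto
    next
      case (2 z)
      then obtain x where "x \<in> I" "z = f x" using s by blast
      then show ?thesis
        using 2 mv_homD(3)[OF f, of x] by (auto intro!: image_eqI[of _ _ "mv_neg N x"])
    qed
  qed
qed

text \<open>Complementation is injective, and \<open>f\<close> cannot identify an element of
  \<open>I\<close> with a complement, since both images would then witness an element of
  \<open>I'\<close> whose complement also lies in \<open>I'\<close>.\<close>

lemma hom_inj_if_inj_on_ideal:
  assumes "couple N I" "couple N' I'" and f: "f \<in> mv_hom N N'" and fI: "f ` I \<subseteq> I'"
    and inj: "inj_on f I"
  shows "inj_on f (carrier N)"
proof -
  interpret A: couple N I by fact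
  interpret B: couple N' I' by fact
  have neg: "f (mv_neg N x) = mv_neg N' (f x)" "f x \<in> I'" if "x \<in> I" for x
    using that fI mv_homD(3)[OF f, of x] by auto
  have eq: "mv_neg N' u = mv_neg N' v \<longleftrightarrow> u = v" if "u \<in> I'" "v \<in> I'" for u v
    using that by (metis B.ideal_closed B.neg_neg)
  have ne: "f x \<noteq> mv_neg N' (f y)" "mv_neg N' (f y) \<noteq> f x" if "x \<in> I" "y \<in> I" for x y
    using that neg(2) B.neg_not_ideal[of "f y"] by metis+
  have "f x = f y \<longleftrightarrow> x = y" if "x \<in> I" "y \<in> I" for x y
    using inj that by (simp add: inj_on_eq_iff)
  then show ?thesis
    by (intro inj_onI) (elim A.carrier_cases; simp add: neg eq ne)
qed

section \<open>Adjoining complements to an EMV-algebra\<close>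

text \<open>The second factor is the two-element MV-algebra, whose sum is disjunction; its value
  records whether an element is a formal complement.\<close>

definition prod_bool :: "'a mv_alg \<Rightarrow> ('a \<times> bool) mv_alg" where
  "prod_bool N =
     \<lparr>carrier = carrier N \<times> UNIV, oplus = (\<lambda>(x, s) (y, t). (x \<oplus>\<^bsub>N\<^esub> y, s \<or> t)),
      ozero = (ozero N, False), mv_neg = (\<lambda>(x, s). (mv_neg N x, \<not> s)), mv_one = (mv_one N, True)\<rparr>"

lemma (in is_mv_algebra) prod_bool_is_mv_algebra: "is_mv_algebra (prod_bool N)"
proof (rule is_mv_algebra.intro)
  show "comm_monoid (oplus_monoid (prod_bool N))"
    by (rule comm_monoidI) (auto simp: oplus_monoid_def prod_bool_def add_ac)
qed (auto simp: prod_bool_def lukasiewicz)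

text \<open>Only \<open>B\<close> is required to be an MV-algebra: equations are to be pulled back
  along \<open>t\<close> to a structure \<open>A\<close> for which the axioms are still
  open.\<close>

definition mv_embedding :: "'a mv_alg \<Rightarrow> 'a set \<Rightarrow> ('a \<Rightarrow> 'b) \<Rightarrow> 'b mv_alg \<Rightarrow> bool" where
  "mv_embedding A S t B \<longleftrightarrow> is_mv_algebra B \<and> inj_on t S \<and> t ` S \<subseteq> carrier B \<and> ozero A \<in> S \<and> mv_one A \<in> S \<and>
     (\<forall>x \<in> S. \<forall>y \<in> S. x \<oplus>\<^bsub>A\<^esub> y \<in> S \<and> t (x \<oplus>\<^bsub>A\<^esub> y) = t x \<oplus>\<^bsub>B\<^esub> t y) \<and>
     (\<forall>x \<in> S. mv_neg A x \<in> S \<and> t (mv_neg A x) = mv_neg B (t x)) \<and>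
     t (ozero A) = ozero B \<and> t (mv_one A) = mv_one B"

text \<open>The axioms involve at most three elements at a time, so embeddings of subsets suffice.\<close>
lemma mv_algebra_if_locally_embedded:
  fixes A :: "'a mv_alg"
  assumes loc: "\<And>x y z. \<lbrakk>x \<in> carrier A; y \<in> carrier A; z \<in> carrier A\<rbrakk>
      \<Longrightarrow> \<exists>S (t :: 'a \<Rightarrow> 'b) B. mv_embedding A S t B \<and> S \<subseteq> carrier A \<and> {x, y, z} \<subseteq> S"
    and ne: "carrier A \<noteq> {}"
  shows "is_mv_algebra A"
proof -
  \<comment> \<open>Any property of three elements may be proved in the presence of an embedding
    whose domain contains them. An axiom holds in \<open>B\<close> and descends through injectivity
    of \<open>t\<close>.\<close>
  have P: "P x y z"
    if xyz: "x \<in> carrier A" "y \<in> carrier A" "z \<in> carrier A"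
      and *: "\<And>S (t :: 'a \<Rightarrow> 'b) B. \<lbrakk>is_mv_algebra B; inj_on t S; S \<subseteq> carrier A;
        \<And>x. x \<in> S \<Longrightarrow> t x \<in> carrier B;
        \<And>x y. \<lbrakk>x \<in> S; y \<in> S\<rbrakk> \<Longrightarrow> x \<oplus>\<^bsub>A\<^esub> y \<in> S; \<And>x. x \<in> S \<Longrightarrow> mv_neg A x \<in> S; ozero A \<in> S; mv_one A \<in> S;
        \<And>x y. \<lbrakk>x \<in> S; y \<in> S\<rbrakk> \<Longrightarrow> t (x \<oplus>\<^bsub>A\<^esub> y) = t x \<oplus>\<^bsub>B\<^esub> t y;
        \<And>x. x \<in> S \<Longrightarrow> t (mv_neg A x) = mv_neg B (t x);
        t (ozero A) = ozero B; t (mv_one A) = mv_one B; x \<in> S; y \<in> S; z \<in> S\<rbrakk> \<Longrightarrow> P x y z"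
    for x y z P
  proof -
    obtain S and t :: "'a \<Rightarrow> 'b" and B
      where "mv_embedding A S t B" "S \<subseteq> carrier A" "x \<in> S" "y \<in> S" "z \<in> S"
      using loc[OF xyz] by auto
    then show ?thesis
      unfolding mv_embedding_def by (intro *[of B t S]) (simp_all add: image_subset_iff)
  qed
  have closed: "x \<oplus>\<^bsub>A\<^esub> y \<in> carrier A" "mv_neg A x \<in> carrier A" "ozero A \<in> carrier A" "mv_one A \<in> carrier A"
    if "x \<in> carrier A" "y \<in> carrier A" for x y
    by (rule P[OF that that(1)]; blast)+
  have 0: "ozero A \<in> carrier A" "mv_one A \<in> carrier A"
    using ne closed(3,4) by blast+
  have eq: "u = v" if "inj_on t S" "u \<in> S" "v \<in> S" "t u = t v" for t :: "'a \<Rightarrow> 'b" and S u v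
    using that by (simp add: inj_on_eq_iff)
  have a: "x \<oplus>\<^bsub>A\<^esub> y \<oplus>\<^bsub>A\<^esub> z = x \<oplus>\<^bsub>A\<^esub> (y \<oplus>\<^bsub>A\<^esub> z)"
    if "x \<in> carrier A" "y \<in> carrier A" "z \<in> carrier A" for x y z
    by (rule P[OF that], erule eq) (simp_all add: is_mv_algebra.add_assoc)
  have c: "x \<oplus>\<^bsub>A\<^esub> y = y \<oplus>\<^bsub>A\<^esub> x" if "x \<in> carrier A" "y \<in> carrier A" for x y
    by (rule P[OF that that(1)], erule eq) (simp_all add: is_mv_algebra.add_comm)
  have z: "ozero A \<oplus>\<^bsub>A\<^esub> x = x" if "x \<in> carrier A" for x
    by (rule P[OF that that that], erule eq) (simp_all add: is_mv_algebra.zero_add)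
  show ?thesis
  proof (rule is_mv_algebra.intro)
    show "comm_monoid (oplus_monoid A)"
      by (rule comm_monoidI) (auto simp: oplus_monoid_def closed 0 a z intro: c)
    show "mv_neg A x \<in> carrier A" if "x \<in> carrier A" for x
      using closed that by blast
    show "mv_one A \<in> carrier A" by (rule 0)
    show "mv_neg A (ozero A) = mv_one A"
      by (rule P[OF 0(1) 0(1) 0(1)], erule eq) (simp_all add: is_mv_algebra.neg_zero)
    show "mv_neg A (mv_neg A x) = x" if "x \<in> carrier A" for x
      by (rule P[OF that that that], erule eq) (simp_all add: is_mv_algebra.neg_neg)
    show "x \<oplus>\<^bsub>A\<^esub> mv_one A = mv_one A" if "x \<in> carrier A" for x
      by (rule P[OF that that that], erule eq) (simp_all add: is_mv_algebra.oplus_one)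
    show "x \<oplus>\<^bsub>A\<^esub> mv_neg A (x \<oplus>\<^bsub>A\<^esub> mv_neg A y) = y \<oplus>\<^bsub>A\<^esub> mv_neg A (y \<oplus>\<^bsub>A\<^esub> mv_neg A x)"
      if "x \<in> carrier A" "y \<in> carrier A" for x y
      by (rule P[OF that that(1)], erule eq) (simp_all add: is_mv_algebra.lukasiewicz)
  qed
qed

text \<open>A strictly larger ideal contains the complement of some \<open>y\<close> in
  \<open>I\<close> as well as \<open>y\<close> itself, hence one and thus the whole carrier.\<close>

lemma (in is_mv_algebra) maximal_ideal_if_complements:
  assumes I: "mv_proper_ideal N I" and N: "carrier N = I \<union> mv_neg N ` I"
  shows "mv_maximal_ideal N I"
proof -
  have False if J: "mv_proper_ideal N J" "I \<subset> J" for J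
  proof -
    have JN: "J \<subseteq> carrier N" "J \<noteq> carrier N"
      and add: "\<And>x y. \<lbrakk>x \<in> J; y \<in> J\<rbrakk> \<Longrightarrow> x \<boxplus> y \<in> J"
      and down: "\<And>x y. \<lbrakk>x \<in> J; y \<in> carrier N; y \<preceq> x\<rbrakk> \<Longrightarrow> y \<in> J"
      using J(1) unfolding mv_proper_ideal_def mv_ideal_def by blast+
    obtain x where "x \<in> J" "x \<notin> I" using J(2) by blast
    then obtain y where y: "y \<in> I" "x = \<sim> y" using JN N by blast
    then have "\<sim> y \<boxplus> y \<in> J" "y \<in> carrier N"
      using \<open>x \<in> J\<close> J(2) JN add by blast+
    then have "\<one>\<^sub>N \<in> J" by simp
    then have "carrier N \<subseteq> J" using down[of "\<one>\<^sub>N"] below_one by blast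
    then show False using JN by blast
  qed
  then show ?thesis using I unfolding mv_maximal_ideal_def by blast
qed

section \<open>Initial segments below idempotents\<close>

context is_emv_algebra
begin

abbreviation compl where "compl b x \<equiv> lam M (ozero M) b x"
abbreviation seg where "seg b \<equiv> interval_mv M (ozero M) b"

lemma idem_above2:
  assumes "x \<in> carrier M" "y \<in> carrier M"
  obtains b where "b \<in> idems M" "x \<preceq> b" "y \<preceq> b"
proof -
  obtain b where b: "b \<in> idems M" "emv_join M x y \<preceq> b"
    using enough_idems[of "emv_join M x y"] assms join_closed by blast
  then show thesis
    using that[of b] assms join_upper[of x y] le_trans[OF _ b(2)]
    by (simp add: idems_closed join_closed)
qed

lemma seg_is_mv_algebra: "b \<in> idems M \<Longrightarrow> is_mv_algebra (seg b)"
  by (rule interval_is_mv) (simp_all add: idems_closed)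

lemma seg_simps [simp]:
  "b \<in> carrier M \<Longrightarrow> carrier (seg b) = {x \<in> carrier M. x \<preceq> b}" "oplus (seg b) = oplus M"
  "ozero (seg b) = ozero M" "mv_neg (seg b) = compl b" "mv_one (seg b) = b"
  by (auto simp: interval_mv_def at_least_at_most_def)

lemma seg_add: "\<lbrakk>b \<in> idems M; x \<in> carrier M; y \<in> carrier M; x \<preceq> b; y \<preceq> b\<rbrakk> \<Longrightarrow> x \<oplus>\<^bsub>M\<^esub> y \<preceq> b"
  using is_mv_algebra.add_closed[OF seg_is_mv_algebra, of b x y] by (simp add: idems_closed)

lemma compl_compl: "\<lbrakk>b \<in> idems M; x \<in> carrier M; x \<preceq> b\<rbrakk> \<Longrightarrow> compl b (compl b x) = x"
  using is_mv_algebra.neg_neg[OF seg_is_mv_algebra, of b x] by (simp add: idems_closed)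

lemma seg_order:
  assumes b: "b \<in> idems M" and x: "x \<in> carrier M" "x \<preceq> b" and y: "y \<in> carrier M" "y \<preceq> b"
  shows "x \<sqsubseteq>\<^bsub>mv_order (seg b)\<^esub> y \<longleftrightarrow> x \<preceq> y"
proof -
  interpret S: is_mv_algebra "seg b" by (rule seg_is_mv_algebra[OF b])
  note c = lam_props[OF b x]
  have "compl b x \<oplus>\<^bsub>M\<^esub> y = b \<longleftrightarrow> x \<preceq> y"
  proof
    assume "compl b x \<oplus>\<^bsub>M\<^esub> y = b"
    then have "compl b (compl b x) \<preceq> y"
      using lam_props(4)[OF b c(1,2), of y] y by simp
    then show "x \<preceq> y" using b x by (simp add: compl_compl)
  next
    assume "x \<preceq> y"
    then have "x \<oplus>\<^bsub>M\<^esub> compl b x \<preceq> y \<oplus>\<^bsub>M\<^esub> compl b x"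
      using x y c(1) by (intro oplus_mono)
    then have "b \<preceq> compl b x \<oplus>\<^bsub>M\<^esub> y"
      using c(1,3) y by (simp add: add_comm[of y])
    then show "compl b x \<oplus>\<^bsub>M\<^esub> y = b"
      using b y c by (intro le_antisym) (simp_all add: seg_add idems_closed)
  qed
  then show ?thesis by (simp add: S.below_iff)
qed

text \<open>The difference of \<open>b\<close> and \<open>x\<close> taken in the larger segment has
  the minimality that defines \<open>compl b x\<close>: this is \<open>rel_complement\<close> with
  lower end zero.\<close>

lemma compl_in_seg:
  assumes d: "d \<in> idems M" and b: "b \<in> idems M" "b \<preceq> d" and x: "x \<in> carrier M" "x \<preceq> b"
  shows "compl b x = is_mv_algebra.diff (seg d) b x"
proof -
  interpret S: is_mv_algebra "seg d" by (rule seg_is_mv_algebra[OF d])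
  have c [simp]: "b \<in> carrier M" "d \<in> carrier M" "ozero M \<preceq> d" using b d by (auto simp: idems_closed)
  have xd: "x \<preceq> d" using le_trans[of x b d] x b by simp
  have id: "b \<in> idems (seg d)" "ozero M \<in> idems (seg d)"
    using b by (simp_all add: idems_def)
  have cD: "S.diff b x \<in> carrier M" "S.diff b x \<preceq> d"
    using S.diff_closed[of b x] b x xd by simp_all
  note r = S.rel_complement[OF id(2,1), of x]
  have "S.diff b x \<preceq> b" "x \<oplus>\<^bsub>M\<^esub> S.diff b x = b"
    using r(3,4) x xd b d cD by (simp_all add: seg_order)
  moreover have "S.diff b x \<preceq> z" if "z \<in> carrier M" "z \<preceq> b" "x \<oplus>\<^bsub>M\<^esub> z = b" for z
    using r(5)[of z] that x xd b d cD le_trans[of z b d] by (simp add: seg_order)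
  ultimately show ?thesis
    using b x cD by (intro lam_eq_if_least) simp_all
qed

text \<open>The idempotent \<open>b\<close> occurs only on the left and \<open>d\<close> only on the
  right. Since two idempotents lie below a common one, the left-hand sides do not depend on
  \<open>b\<close>.\<close>

lemma compl_ops_in_seg:
  assumes d: "d \<in> idems M" and b: "b \<in> idems M" "b \<preceq> d"
    and x: "x \<in> carrier M" "x \<preceq> b" and y: "y \<in> carrier M" "y \<preceq> b"
  shows "compl b (compl b x \<oplus>\<^bsub>M\<^esub> y) = is_mv_algebra.diff (seg d) x y"
    and "compl b (compl b x \<oplus>\<^bsub>M\<^esub> compl b y) = is_mv_algebra.prod2 (seg d) x y"
proof -
  interpret S: is_mv_algebra "seg d" by (rule seg_is_mv_algebra[OF d])
  have c [simp]: "b \<in> carrier M" "d \<in> carrier M" using b d by (auto simp: idems_closed)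
  have bd: "b \<in> idems (seg d)"
    using b by (simp add: idems_def)
  have xd: "x \<preceq> d" "y \<preceq> d" using le_trans[OF _ b(2)] x y by simp_all
  have cx: "compl b x \<in> carrier M" "compl b x \<preceq> b" and cy: "compl b y \<in> carrier M" "compl b y \<preceq> b"
    using lam_props[OF b(1)] x y by simp_all
  have "compl b (compl b x \<oplus>\<^bsub>M\<^esub> y) = S.diff b (S.diff b x \<oplus>\<^bsub>M\<^esub> y)"
    using b cx cy x y d
    by (simp add: compl_in_seg[OF d b, of "compl b x \<oplus>\<^bsub>M\<^esub> y"] seg_add) (simp add: compl_in_seg[OF d b])
  also have "\<dots> = S.diff x y"
    using S.diff_via_complement[of y x b] x y xd b d by (simp add: seg_order)
  finally show "compl b (compl b x \<oplus>\<^bsub>M\<^esub> y) = S.diff x y" .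
  have "compl b (compl b x \<oplus>\<^bsub>M\<^esub> compl b y) = S.diff b (S.diff b x \<oplus>\<^bsub>M\<^esub> S.diff b y)"
    using b cx cy x y d
    by (simp add: compl_in_seg[OF d b, of "compl b x \<oplus>\<^bsub>M\<^esub> compl b y"] seg_add) (simp add: compl_in_seg[OF d b])
  also have "\<dots> = S.prod2 x y"
    using S.product_via_complement[of x y b] x y xd b d bd by (simp add: seg_order)
  finally show "compl b (compl b x \<oplus>\<^bsub>M\<^esub> compl b y) = S.prod2 x y" .
qed

section \<open>Difference and product on the whole EMV-algebra\<close>

definition common_idem where "common_idem x y = (SOME b. b \<in> idems M \<and> x \<preceq> b \<and> y \<preceq> b)"

definition ediff where
  "ediff x y = (let b = common_idem x y in compl b (compl b x \<oplus>\<^bsub>M\<^esub> y))"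

definition eprod where
  "eprod x y = (let b = common_idem x y in compl b (compl b x \<oplus>\<^bsub>M\<^esub> compl b y))"

lemma common_idem:
  assumes "x \<in> carrier M" "y \<in> carrier M"
  shows "common_idem x y \<in> idems M" "x \<preceq> common_idem x y" "y \<preceq> common_idem x y"
proof -
  obtain b where "b \<in> idems M \<and> x \<preceq> b \<and> y \<preceq> b"
    using idem_above2[OF assms] by blast
  then have "common_idem x y \<in> idems M \<and> x \<preceq> common_idem x y \<and> y \<preceq> common_idem x y"
    unfolding common_idem_def by (rule someI)
  then show "common_idem x y \<in> idems M" "x \<preceq> common_idem x y" "y \<preceq> common_idem x y"
    by blast+
qed

text \<open>The chosen idempotent and \<open>b\<close> are compared in the segment below their sum,
  which is again idempotent. So the choice in \<open>common_idem\<close> is immaterial.\<close>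

lemma ediff_eprod_eq:
  assumes x: "x \<in> carrier M" "x \<preceq> b" and y: "y \<in> carrier M" "y \<preceq> b" and b: "b \<in> idems M"
  shows "ediff x y = compl b (compl b x \<oplus>\<^bsub>M\<^esub> y)"
    and "eprod x y = compl b (compl b x \<oplus>\<^bsub>M\<^esub> compl b y)"
proof -
  let ?c = "common_idem x y"
  note c = common_idem[OF x(1) y(1)]
  have d: "?c \<oplus>\<^bsub>M\<^esub> b \<in> idems M" "?c \<preceq> ?c \<oplus>\<^bsub>M\<^esub> b" "b \<preceq> ?c \<oplus>\<^bsub>M\<^esub> b"
    using b c le_add[of ?c b] le_add[of b ?c] by (simp_all add: idem_add idems_closed add_comm)
  show "ediff x y = compl b (compl b x \<oplus>\<^bsub>M\<^esub> y)"
    unfolding ediff_def Let_def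
    using compl_ops_in_seg(1)[OF d(1) c(1) d(2) x(1) c(2) y(1) c(3)]
      compl_ops_in_seg(1)[OF d(1) b d(3) x y] by simp
  show "eprod x y = compl b (compl b x \<oplus>\<^bsub>M\<^esub> compl b y)"
    unfolding eprod_def Let_def
    using compl_ops_in_seg(2)[OF d(1) c(1) d(2) x(1) c(2) y(1) c(3)]
      compl_ops_in_seg(2)[OF d(1) b d(3) x y] by simp
qed

lemma ediff_eprod_closed:
  assumes x: "x \<in> carrier M" "x \<preceq> b" and y: "y \<in> carrier M" "y \<preceq> b" and b: "b \<in> idems M"
  shows "ediff x y \<in> carrier M" "ediff x y \<preceq> b" "eprod x y \<in> carrier M" "eprod x y \<preceq> b"
proof -
  note cx = lam_props(1,2)[OF b x] and cy = lam_props(1,2)[OF b y]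
  show "ediff x y \<in> carrier M" "ediff x y \<preceq> b" "eprod x y \<in> carrier M" "eprod x y \<preceq> b"
    unfolding ediff_eprod_eq[OF assms]
    using cx cy y b seg_add[OF b cx(1) y(1) cx(2) y(2)] seg_add[OF b cx(1) cy(1) cx(2) cy(2)]
    by (simp_all add: lam_props)
qed

lemma compl_ediff_eprod:
  assumes x: "x \<in> carrier M" "x \<preceq> b" and y: "y \<in> carrier M" "y \<preceq> b" and b: "b \<in> idems M"
  shows "compl b (ediff x y) = compl b x \<oplus>\<^bsub>M\<^esub> y" "compl b (eprod x y) = compl b x \<oplus>\<^bsub>M\<^esub> compl b y"
  unfolding ediff_eprod_eq[OF assms]
  using lam_props(1,2)[OF b x] lam_props(1,2)[OF b y] y b by (simp_all add: compl_compl seg_add)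

text \<open>In a segment containing both elements this is \<open>diff_eq_zero_iff\<close>. It will
  identify the order of the unitization on the copy of \<open>M\<close>.\<close>

lemma ediff_eq_zero_iff:
  assumes x: "x \<in> carrier M" and y: "y \<in> carrier M"
  shows "ediff x y = ozero M \<longleftrightarrow> x \<preceq> y"
proof -
  obtain b where b: "b \<in> idems M" "x \<preceq> b" "y \<preceq> b"
    using idem_above2[OF x y] .
  interpret S: is_mv_algebra "seg b" by (rule seg_is_mv_algebra[OF b(1)])
  have "ediff x y = S.diff x y"
    using x y b by (simp add: ediff_eprod_eq(1)[of x b y] compl_ops_in_seg(1) idems_closed)
  then show ?thesis
    using S.diff_eq_zero_iff[of x y] x y b by (simp add: seg_order idems_closed)
qed

text \<open>The cases are forced by the identities \<open>add_neg_neg\<close>,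
  \<open>add_neg_left\<close> and \<open>add_neg_right\<close>, valid in every MV-algebra.\<close>

definition unit_add :: "'a \<times> bool \<Rightarrow> 'a \<times> bool \<Rightarrow> 'a \<times> bool" where
  "unit_add = (\<lambda>(x, s) (y, t).
     if s then if t then (eprod x y, True) else (ediff x y, True)
     else if t then (ediff y x, True) else (x \<oplus>\<^bsub>M\<^esub> y, False))"

text \<open>The pairs \<open>(x, False)\<close> and \<open>(x, True)\<close> stand for \<open>x\<close> and its formal complement. The encoding
  \<open>e\<close> is there because the result has to live on a prescribed type.\<close>
definition unitization :: "('a \<times> bool \<Rightarrow> 'b) \<Rightarrow> 'b mv_alg" where
  "unitization e =
     (let d = inv_into (carrier M \<times> UNIV) e in
      \<lparr>carrier = e ` (carrier M \<times> UNIV), oplus = (\<lambda>u v. e (unit_add (d u) (d v))),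
       ozero = e (ozero M, False), mv_neg = (\<lambda>u. e (apsnd Not (d u))), mv_one = e (ozero M, True)\<rparr>)"

section \<open>The unitization as a couple\<close>

context
  fixes e :: "'a \<times> bool \<Rightarrow> 'b"
  assumes e: "inj_on e (carrier M \<times> UNIV)"
begin

abbreviation U where "U \<equiv> unitization e"
abbreviation UI where "UI \<equiv> e ` (carrier M \<times> {False})"

lemma U_simps [simp]:
  "carrier U = e ` (carrier M \<times> UNIV)" "ozero U = e (ozero M, False)" "mv_one U = e (ozero M, True)"
  "x \<in> carrier M \<Longrightarrow> mv_neg U (e (x, s)) = e (x, \<not> s)"
  "\<lbrakk>x \<in> carrier M; y \<in> carrier M\<rbrakk> \<Longrightarrow> e (x, s) \<oplus>\<^bsub>U\<^esub> e (y, t) = e (unit_add (x, s) (y, t))"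
  using e by (simp_all add: unitization_def Let_def)

lemma e_eq_iff [simp]: "\<lbrakk>x \<in> carrier M; y \<in> carrier M\<rbrakk> \<Longrightarrow> e (x, s) = e (y, t) \<longleftrightarrow> x = y \<and> s = t"
  using e by (auto dest: inj_onD)

definition unit_embed :: "'a \<Rightarrow> 'b \<Rightarrow> 'a \<times> bool" where
  "unit_embed b u =
     (case inv_into (carrier M \<times> UNIV) e u of (x, s) \<Rightarrow> (if s then compl b x else x, s))"

lemma unit_embed [simp]:
  "x \<in> carrier M \<Longrightarrow> unit_embed b (e (x, s)) = (if s then compl b x else x, s)"
  using e by (simp add: unit_embed_def)

text \<open>By \<open>compl_ediff_eprod\<close>, complementing an \<open>ediff\<close> or
  \<open>eprod\<close> below \<open>b\<close> yields a sum of elements of the segment, so the four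
  cases of \<open>unit_add\<close> become the componentwise sum.\<close>

lemma unit_embedding:
  assumes b: "b \<in> idems M"
  shows "mv_embedding U (e ` (carrier (seg b) \<times> UNIV)) (unit_embed b) (prod_bool (seg b))"
proof -
  interpret S: is_mv_algebra "seg b" by (rule seg_is_mv_algebra[OF b])
  have [simp]: "b \<in> carrier M" using b by (rule idems_closed)
  have inj: "x = y" if "compl b x = compl b y" "x \<in> carrier M" "x \<preceq> b" "y \<in> carrier M" "y \<preceq> b" for x y
    using that compl_compl[OF b] by metis
  note c [simp] = lam_props(1,2)[OF b]
  have z: "compl b (ozero M) = b"
    using S.neg_zero by simp
  have "inj_on (unit_embed b) (e ` (carrier (seg b) \<times> UNIV))"
    by (rule inj_onI) (auto intro: inj split: if_splits)
  moreover have "unit_embed b ` e ` (carrier (seg b) \<times> UNIV) \<subseteq> carrier (prod_bool (seg b))"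
    by (auto simp: prod_bool_def)
  moreover have "u \<oplus>\<^bsub>U\<^esub> v \<in> e ` (carrier (seg b) \<times> UNIV) \<and>
      unit_embed b (u \<oplus>\<^bsub>U\<^esub> v) = unit_embed b u \<oplus>\<^bsub>prod_bool (seg b)\<^esub> unit_embed b v"
    if uv: "u \<in> e ` (carrier (seg b) \<times> UNIV)" "v \<in> e ` (carrier (seg b) \<times> UNIV)" for u v
  proof -
    obtain x s y t where u: "u = e (x, s)" "x \<in> carrier M" "x \<preceq> b"
      and v: "v = e (y, t)" "y \<in> carrier M" "y \<preceq> b"
      using uv by auto
    note cl = ediff_eprod_closed[OF u(2,3) v(2,3) b] ediff_eprod_closed[OF v(2,3) u(2,3) b]
    note eq = compl_ediff_eprod[OF u(2,3) v(2,3) b] compl_ediff_eprod[OF v(2,3) u(2,3) b]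
    have "fst (unit_add (x, s) (y, t)) \<in> carrier M \<and> fst (unit_add (x, s) (y, t)) \<preceq> b"
      using u v cl b by (simp add: unit_add_def seg_add)
    then show ?thesis
      using u v cl eq b
      by (cases s; cases t) (auto simp: unit_add_def prod_bool_def add_comm[of x "compl b y"])
  qed
  moreover have "mv_neg U u \<in> e ` (carrier (seg b) \<times> UNIV) \<and>
      unit_embed b (mv_neg U u) = mv_neg (prod_bool (seg b)) (unit_embed b u)"
    if "u \<in> e ` (carrier (seg b) \<times> UNIV)" for u
    using that b by (auto simp: prod_bool_def compl_compl)
  ultimately show ?thesis
    using S.prod_bool_is_mv_algebra
    unfolding mv_embedding_def by (auto simp: prod_bool_def z)
qed

lemma unitization_is_mv_algebra: "is_mv_algebra U"
proof (rule mv_algebra_if_locally_embedded)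
  fix u v w assume "u \<in> carrier U" "v \<in> carrier U" "w \<in> carrier U"
  then obtain x y z r s t where xyz: "x \<in> carrier M" "y \<in> carrier M" "z \<in> carrier M"
    and uvw: "u = e (x, r)" "v = e (y, s)" "w = e (z, t)"
    by auto
  obtain a where a: "a \<in> idems M" "x \<preceq> a" "y \<preceq> a"
    using idem_above2[OF xyz(1,2)] .
  obtain b where b: "b \<in> idems M" "a \<preceq> b" "z \<preceq> b"
    using idem_above2[OF idems_closed[OF a(1)] xyz(3)] .
  have "x \<preceq> b" "y \<preceq> b"
    using le_trans[OF _ b(2)] a b xyz by (simp_all add: idems_closed)
  then have "{u, v, w} \<subseteq> e ` (carrier (seg b) \<times> UNIV)"
    using b xyz uvw by (simp add: idems_closed)
  moreover have "e ` (carrier (seg b) \<times> UNIV) \<subseteq> carrier U"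
    using b by (auto simp: idems_closed)
  ultimately show "\<exists>S (t :: 'b \<Rightarrow> 'a \<times> bool) B. mv_embedding U S t B \<and> S \<subseteq> carrier U \<and> {u, v, w} \<subseteq> S"
    using unit_embedding[OF b(1)] by blast
qed auto

text \<open>The first comparison says that the formal complement of \<open>ediff x y\<close> is one,
  i.e. that \<open>ediff x y\<close> is zero. In the second, the sum to be compared with one carries
  the flag \<open>False\<close>, whereas one carries \<open>True\<close>.\<close>

lemma unitization_order:
  assumes "x \<in> carrier M" "y \<in> carrier M"
  shows "e (x, False) \<sqsubseteq>\<^bsub>mv_order U\<^esub> e (y, False) \<longleftrightarrow> x \<preceq> y"
    and "\<not> e (x, True) \<sqsubseteq>\<^bsub>mv_order U\<^esub> e (y, False)"
proof -
  obtain b where b: "b \<in> idems M" "x \<preceq> b" "y \<preceq> b"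
    using idem_above2[OF assms] .
  have "ediff x y \<in> carrier M"
    using ediff_eprod_closed assms b by blast
  then show "e (x, False) \<sqsubseteq>\<^bsub>mv_order U\<^esub> e (y, False) \<longleftrightarrow> x \<preceq> y"
    using assms by (simp add: mv_order_def unit_add_def ediff_eq_zero_iff)
  show "\<not> e (x, True) \<sqsubseteq>\<^bsub>mv_order U\<^esub> e (y, False)"
    using assms by (simp add: mv_order_def unit_add_def)
qed

text \<open>Down-closure holds because no formal complement lies below an element of
  \<open>M\<close>, and maximality because everything else is a complement. The idempotents come
  from those of \<open>M\<close>.\<close>

lemma unitization_couple: "pmv_couple U UI"
proof -
  interpret U: is_mv_algebra U by (rule unitization_is_mv_algebra)
  have down: "v \<in> UI" if uv: "u \<in> UI" "v \<in> carrier U" "v \<sqsubseteq>\<^bsub>mv_order U\<^esub> u" for u v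
  proof -
    obtain x y s where "u = e (x, False)" "x \<in> carrier M" "v = e (y, s)" "y \<in> carrier M"
      using uv(1,2) by auto
    then show ?thesis
      using unitization_order(2)[of y x] uv(3) by (cases s) auto
  qed
  have ideal: "mv_ideal U UI"
    unfolding mv_ideal_def
  proof (intro conjI ballI impI)
    show "u \<oplus>\<^bsub>U\<^esub> v \<in> UI" if "u \<in> UI" "v \<in> UI" for u v
      using that by (auto simp: unit_add_def)
    show "UI \<noteq> {}" using zero_closed by blast
    show "UI \<subseteq> carrier U" by auto
    show "v \<in> UI" if "u \<in> UI" "v \<in> carrier U" "v \<sqsubseteq>\<^bsub>mv_order U\<^esub> u" for u v
      using that by (rule down)
  qed
  have "e (ozero M, True) \<notin> UI" "e (ozero M, True) \<in> carrier U"
    by auto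
  then have "mv_proper_ideal U UI"
    using ideal unfolding mv_proper_ideal_def by metis
  moreover have compl: "carrier U = UI \<union> mv_neg U ` UI"
  proof -
    have "mv_neg U ` UI = e ` (carrier M \<times> {True})"
      by (force simp: image_iff)
    moreover have "carrier M \<times> UNIV = carrier M \<times> {False} \<union> carrier M \<times> {True}"
      by auto
    ultimately show ?thesis by (simp add: image_Un)
  qed
  ultimately have max: "mv_maximal_ideal U UI"
    by (rule U.maximal_ideal_if_complements)
  have idem: "\<exists>a \<in> UI \<inter> idems U. u \<sqsubseteq>\<^bsub>mv_order U\<^esub> a" if u: "u \<in> UI" for u
  proof -
    obtain x where x: "u = e (x, False)" "x \<in> carrier M"
      using u by auto
    obtain a where a: "a \<in> idems M" "x \<preceq> a"
      using enough_idems[OF x(2)] by blast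
    then have "e (a, False) \<in> UI \<inter> idems U"
      by (auto simp: idems_def unit_add_def)
    then show ?thesis
      using x a unitization_order(1)[of x a] by (auto simp: idems_closed)
  qed
  show ?thesis
    unfolding pmv_couple_def
    by (intro conjI ballI unitization_is_mv_algebra max idem compl)
qed

end

end

section \<open>Essential surjectivity\<close>

text \<open>Joins, meets, zero and \<open>lam\<close> are determined by the order and the sum, so a
  bijection respecting these two respects all of them.\<close>

lemma emv_hom_if_order_iso:
  assumes "is_emv_algebra M" "is_emv_algebra M'"
    and f: "bij_betw f (carrier M) (carrier M')"
    and ord: "\<And>x y. \<lbrakk>x \<in> carrier M; y \<in> carrier M\<rbrakk>
      \<Longrightarrow> f x \<sqsubseteq>\<^bsub>emv_order M'\<^esub> f y \<longleftrightarrow> x \<sqsubseteq>\<^bsub>emv_order M\<^esub> y"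
    and add: "\<And>x y. \<lbrakk>x \<in> carrier M; y \<in> carrier M\<rbrakk> \<Longrightarrow> f (x \<oplus>\<^bsub>M\<^esub> y) = f x \<oplus>\<^bsub>M'\<^esub> f y"
  shows "restrict f (carrier M) \<in> emv_hom M M'"
proof -
  interpret A: is_emv_algebra M by fact
  interpret B: is_emv_algebra M' by fact
  have cl [simp]: "f x \<in> carrier M'" if "x \<in> carrier M" for x
    using f that by (auto simp: bij_betw_def)
  have inj: "f x = f y \<longleftrightarrow> x = y" if "x \<in> carrier M" "y \<in> carrier M" for x y
    using f that by (auto simp: bij_betw_def inj_on_eq_iff)
  have surj: "\<exists>x \<in> carrier M. z = f x" if "z \<in> carrier M'" for z
    using f that by (auto simp: bij_betw_def)
  have join: "f (emv_join M x y) = emv_join M' (f x) (f y)"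
    if xy: "x \<in> carrier M" "y \<in> carrier M" for x y
  proof (rule B.le_antisym)
    \<comment> \<open>The preimage of the join in \<open>M'\<close>; reflecting the order makes it
      an upper bound of \<open>x\<close> and \<open>y\<close>.\<close>
    obtain w where w: "w \<in> carrier M" "emv_join M' (f x) (f y) = f w"
      using surj[OF B.join_closed] xy cl by metis
    have "emv_join M x y \<sqsubseteq>\<^bsub>emv_order M\<^esub> w"
      using xy w B.join_upper[of "f x" "f y"] by (intro A.join_least) (simp_all add: ord)
    then show "f (emv_join M x y) \<sqsubseteq>\<^bsub>emv_order M'\<^esub> emv_join M' (f x) (f y)"
      using xy w by (simp add: ord A.join_closed)
    show "emv_join M' (f x) (f y) \<sqsubseteq>\<^bsub>emv_order M'\<^esub> f (emv_join M x y)"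
      using xy by (intro B.join_least) (simp_all add: ord A.join_closed A.join_upper)
  qed (use xy in \<open>simp_all add: A.join_closed B.join_closed\<close>)
  have meet: "f (emv_meet M x y) = emv_meet M' (f x) (f y)"
    if xy: "x \<in> carrier M" "y \<in> carrier M" for x y
  proof (rule B.le_antisym)
    obtain w where w: "w \<in> carrier M" "emv_meet M' (f x) (f y) = f w"
      using surj[OF B.meet_closed] xy cl by metis
    have "w \<sqsubseteq>\<^bsub>emv_order M\<^esub> emv_meet M x y"
      using xy w B.meet_lower[of "f x" "f y"] by (intro A.meet_greatest) (simp_all add: ord)
    then show "emv_meet M' (f x) (f y) \<sqsubseteq>\<^bsub>emv_order M'\<^esub> f (emv_meet M x y)"
      using xy w by (simp add: ord A.meet_closed)
    show "f (emv_meet M x y) \<sqsubseteq>\<^bsub>emv_order M'\<^esub> emv_meet M' (f x) (f y)"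
      using xy by (intro B.meet_greatest) (simp_all add: ord A.meet_closed A.meet_lower)
  qed (use xy in \<open>simp_all add: A.meet_closed B.meet_closed\<close>)
  have zero: "f (ozero M) = ozero M'"
  proof -
    obtain w where "w \<in> carrier M" "ozero M' = f w"
      using surj[OF B.zero_closed] by blast
    then have "f (ozero M) \<sqsubseteq>\<^bsub>emv_order M'\<^esub> ozero M'"
      by (simp add: ord)
    then show ?thesis by (intro B.le_antisym) simp_all
  qed
  have lam: "f (lam M (ozero M) b x) = lam M' (ozero M') (f b) (f x)"
    if b: "b \<in> idems M" and x: "x \<in> carrier M" "x \<sqsubseteq>\<^bsub>emv_order M\<^esub> b" for b x
  proof (rule B.lam_eq_if_least[symmetric])
    have [simp]: "b \<in> carrier M" using b by (rule A.idems_closed)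
    note c = A.lam_props[OF b x]
    show "f b \<in> idems M'"
      using b by (simp add: idems_def flip: add)
    show "f x \<in> carrier M'" "f (lam M (ozero M) b x) \<in> carrier M'"
      using x c by simp_all
    show "f x \<sqsubseteq>\<^bsub>emv_order M'\<^esub> f b" "f (lam M (ozero M) b x) \<sqsubseteq>\<^bsub>emv_order M'\<^esub> f b"
      using x c by (simp_all add: ord)
    show "f x \<oplus>\<^bsub>M'\<^esub> f (lam M (ozero M) b x) = f b"
      using x c by (simp flip: add)
    fix z assume z: "z \<in> carrier M'" "z \<sqsubseteq>\<^bsub>emv_order M'\<^esub> f b" "f x \<oplus>\<^bsub>M'\<^esub> z = f b"
    obtain w where w: "w \<in> carrier M" "z = f w" using surj[OF z(1)] by blast
    have "w \<sqsubseteq>\<^bsub>emv_order M\<^esub> b" "x \<oplus>\<^bsub>M\<^esub> w = b"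
      using w z x inj[of "x \<oplus>\<^bsub>M\<^esub> w" b] by (simp_all add: ord add)
    then show "f (lam M (ozero M) b x) \<sqsubseteq>\<^bsub>emv_order M'\<^esub> z"
      using w c by (simp add: ord)
  qed
  show ?thesis
    unfolding emv_hom_def using A.lam_props(1)
    by (auto simp: join meet add zero lam A.join_closed A.meet_closed A.idems_closed at_least_at_most_def)
qed

text \<open>The hypotheses pass to the inverse bijection, so \<open>emv_hom_if_order_iso\<close>
  applies in both directions.\<close>

lemma PEMV_iso_if_order_iso:
  assumes M: "is_proper_emv M" and M': "is_proper_emv M'"
    and f: "bij_betw f (carrier M) (carrier M')"
    and ord: "\<And>x y. \<lbrakk>x \<in> carrier M; y \<in> carrier M\<rbrakk>
      \<Longrightarrow> f x \<sqsubseteq>\<^bsub>emv_order M'\<^esub> f y \<longleftrightarrow> x \<sqsubseteq>\<^bsub>emv_order M\<^esub> y"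
    and add: "\<And>x y. \<lbrakk>x \<in> carrier M; y \<in> carrier M\<rbrakk> \<Longrightarrow> f (x \<oplus>\<^bsub>M\<^esub> y) = f x \<oplus>\<^bsub>M'\<^esub> f y"
  shows "is_iso PEMV M M' (restrict f (carrier M))"
proof -
  interpret A: is_emv_algebra M using M by (simp add: is_proper_emv_def)
  interpret B: is_emv_algebra M' using M' by (simp add: is_proper_emv_def)
  let ?g = "inv_into (carrier M) f"
  have g: "?g z \<in> carrier M" "f (?g z) = z" if "z \<in> carrier M'" for z
    using f that by (auto simp: bij_betw_def inv_into_into f_inv_into_f)
  have gf: "?g (f x) = x" if "x \<in> carrier M" for x
    using f that by (simp add: bij_betw_def)
  have cl: "f x \<in> carrier M'" if "x \<in> carrier M" for x
    using f that by (auto simp: bij_betw_def)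
  have "restrict f (carrier M) \<in> emv_hom M M'"
    using emv_hom_if_order_iso[OF A.is_emv_algebra_axioms B.is_emv_algebra_axioms f ord add] .
  moreover have "restrict ?g (carrier M') \<in> emv_hom M' M"
  proof (rule emv_hom_if_order_iso[OF B.is_emv_algebra_axioms A.is_emv_algebra_axioms])
    show "bij_betw ?g (carrier M') (carrier M)"
      using f by (rule bij_betw_inv_into)
    fix z w assume zw: "z \<in> carrier M'" "w \<in> carrier M'"
    show "?g z \<sqsubseteq>\<^bsub>emv_order M\<^esub> ?g w \<longleftrightarrow> z \<sqsubseteq>\<^bsub>emv_order M'\<^esub> w"
      using ord[of "?g z" "?g w"] zw g by simp
    have "f (?g z \<oplus>\<^bsub>M\<^esub> ?g w) = z \<oplus>\<^bsub>M'\<^esub> w"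
      using zw g by (simp add: add)
    then show "?g (z \<oplus>\<^bsub>M'\<^esub> w) = ?g z \<oplus>\<^bsub>M\<^esub> ?g w"
      using gf[of "?g z \<oplus>\<^bsub>M\<^esub> ?g w"] zw g by simp
  qed
  moreover have "compose (carrier M) (restrict ?g (carrier M')) (restrict f (carrier M)) = (\<lambda>x \<in> carrier M. x)"
    "compose (carrier M') (restrict f (carrier M)) (restrict ?g (carrier M')) = (\<lambda>x \<in> carrier M'. x)"
    using g gf cl by (auto simp: compose_def fun_eq_iff)
  ultimately show ?thesis
    unfolding is_iso_def by auto
qed

context is_emv_algebra
begin

section \<open>Encoding two copies of the carrier in one type\<close>

lemma finite_upper_bound:
  assumes "finite F" "F \<subseteq> carrier M" shows "\<exists>u \<in> carrier M. \<forall>x \<in> F. x \<preceq> u"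
  using assms
proof (induction F)
  case empty
  then show ?case using zero_closed by blast
next
  case (insert a F)
  then obtain u where u: "u \<in> carrier M" "\<forall>x \<in> F. x \<preceq> u" by auto
  have "x \<preceq> emv_join M a u" if "x \<in> insert a F" for x
    using that insert.prems u join_upper[of a u] le_trans[of x u "emv_join M a u"]
    by (auto simp: join_closed)
  then show ?case using u insert.prems by (auto intro: join_closed)
qed

text \<open>A finite carrier would have an upper bound inside itself, which would be a greatest
  element.\<close>

lemma infinite_if_proper: "is_proper_emv M \<Longrightarrow> infinite (carrier M)"
  using finite_upper_bound[of "carrier M"] by (auto simp: is_proper_emv_def greatest_def)

text \<open>Doubling an infinite cardinal does not enlarge it. This keeps the unitization on the
  type of \<open>M\<close>, as the category of couples over that type requires.\<close>

lemma ex_encoding: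
  includes cardinal_syntax
  assumes "is_proper_emv M"
  shows "\<exists>e :: 'a \<times> bool \<Rightarrow> 'a. inj_on e (carrier M \<times> UNIV)"
proof -
  have "infinite (carrier M)" using assms by (rule infinite_if_proper)
  moreover have "|UNIV :: bool set| \<le>o |carrier M|"
    using \<open>infinite (carrier M)\<close>
    by (intro ordLess_imp_ordLeq finite_ordLess_infinite) (simp_all add: card_of_well_order_on Field_card_of)
  ultimately have "|carrier M \<times> (UNIV :: bool set)| =o |carrier M|"
    by (simp add: card_of_Times_infinite)
  then obtain e :: "'a \<times> bool \<Rightarrow> 'a" where "bij_betw e (carrier M \<times> UNIV) (carrier M)"
    using card_of_ordIso by blast
  then show ?thesis by (auto simp: bij_betw_def)
qed

end

lemma Phi_essentially_surjective:
  fixes M :: "'a emv_alg"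
  assumes M: "is_proper_emv M"
  shows "\<exists>X \<in> Obj PMV. \<exists>f. is_iso PEMV (on_obj Phi X) M f"
proof -
  interpret is_emv_algebra M using M by (simp add: is_proper_emv_def)
  obtain e :: "'a \<times> bool \<Rightarrow> 'a" where e: "inj_on e (carrier M \<times> UNIV)"
    using ex_encoding[OF M] by blast
  let ?U = "unitization e" and ?I = "e ` (carrier M \<times> {False})"
  \<comment> \<open>Decode and drop the flag. The flag is \<open>False\<close> throughout
    \<open>?I\<close>, so nothing is lost there.\<close>
  let ?f = "\<lambda>u. fst (inv_into (carrier M \<times> UNIV) e u)"
  have C: "couple ?U ?I"
    using unitization_couple[OF e] by (simp add: couple_iff)
  interpret C: couple ?U ?I by (rule C)
  have "\<not> greatest (mv_order ?U) g ?I" for g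
  proof
    assume g: "greatest (mv_order ?U) g ?I"
    then obtain x where x: "g = e (x, False)" "x \<in> carrier M"
      by (auto simp: greatest_def)
    have "y \<preceq> x" if "y \<in> carrier M" for y
      using g x that unitization_order(1)[OF e that x(2)] by (auto simp: greatest_def)
    then have "greatest (emv_order M) x (carrier M)"
      using x by (simp add: greatest_def)
    then show False using M by (auto simp: is_proper_emv_def)
  qed
  then have obj: "(?U, ?I) \<in> Obj PMV" and proper: "is_proper_emv C.M"
    using C.couple by (auto simp: C.proper_iff)
  have fe: "?f (e (x, s)) = x" if "x \<in> carrier M" for x s
    using e that by simp
  have "is_iso PEMV C.M M (restrict ?f (carrier C.M))"
  proof (rule PEMV_iso_if_order_iso[OF proper M])
    show "bij_betw ?f (carrier C.M) (carrier M)"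
      by (rule bij_betw_byWitness[where f' = "\<lambda>x. e (x, False)"]) (auto simp: fe)
    fix u v assume uv: "u \<in> carrier C.M" "v \<in> carrier C.M"
    then obtain x y where x: "u = e (x, False)" "x \<in> carrier M" and y: "v = e (y, False)" "y \<in> carrier M"
      by auto
    show "?f u \<preceq> ?f v \<longleftrightarrow> u \<sqsubseteq>\<^bsub>emv_order C.M\<^esub> v"
      using uv x y unitization_order(1)[OF e x(2) y(2)] by (simp add: fe)
    show "?f (u \<oplus>\<^bsub>C.M\<^esub> v) = ?f u \<oplus>\<^bsub>M\<^esub> ?f v"
      using x y U_simps(5)[OF e x(2) y(2)] by (simp add: fe unit_add_def)
  qed
  then show ?thesis using obj by (intro bexI[of _ "(?U, ?I)"]) auto
qed

theorem theorem6p4: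
  shows "is_equivalence (PMV :: ('a mv_alg \<times> 'a set, 'a \<Rightarrow> 'a) cat) PEMV Phi \<and>
    (\<forall>(N :: 'a mv_alg) I N' I' h.
       (N, I) \<in> Obj PMV \<and> (N', I') \<in> Obj PMV \<and>
       h \<in> Hom PEMV (on_obj Phi (N, I)) (on_obj Phi (N', I')) \<longrightarrow>
       (\<exists>!\<phi>. \<phi> \<in> Hom PMV (N, I) (N', I') \<and> h = on_mor Phi (N, I) (N', I') \<phi>) \<and>
       (\<forall>\<phi>. \<phi> \<in> Hom PMV (N, I) (N', I') \<and> h = on_mor Phi (N, I) (N', I') \<phi> \<longrightarrow>
          (h ` I = I' \<longrightarrow> \<phi> ` carrier N = carrier N') \<and>
          (inj_on h I \<longrightarrow> inj_on \<phi> (carrier N))))"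
proof (intro conjI allI impI)
  \<comment> \<open>Existence is fullness and uniqueness is faithfulness, so this serves both for
    the equivalence and for the unique extension of \<open>h\<close>.\<close>
  have full: "\<exists>!\<phi>. \<phi> \<in> Hom PMV (N, I) (N', I') \<and> h = on_mor Phi (N, I) (N', I') \<phi>"
    if "(N, I) \<in> Obj PMV" "(N', I') \<in> Obj PMV" "h \<in> Hom PEMV (on_obj Phi (N, I)) (on_obj Phi (N', I'))"
    for N N' :: "'a mv_alg" and I I' h
    using extend_hom_unique[of N I N' I' h] that by (simp add: couple_iff)
  show "is_equivalence (PMV :: ('a mv_alg \<times> 'a set, 'a \<Rightarrow> 'a) cat) PEMV Phi"
  proof (rule equivalence_if_fully_faithful_ess_surj[OF Phi_functor])
    fix X Y :: "'a mv_alg \<times> 'a set" and h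
    assume *: "X \<in> Obj PMV" "Y \<in> Obj PMV" "h \<in> Hom PEMV (on_obj Phi X) (on_obj Phi Y)"
    obtain N I N' I' where "X = (N, I)" "Y = (N', I')" by (cases X, cases Y)
    then show "\<exists>!f. f \<in> Hom PMV X Y \<and> on_mor Phi X Y f = h"
      using full[of N I N' I' h] * by (simp only: eq_commute[of h])
  qed (simp add: Phi_essentially_surjective)
  fix N N' :: "'a mv_alg" and I I' h
  assume *: "(N, I) \<in> Obj PMV \<and> (N', I') \<in> Obj PMV \<and>
    h \<in> Hom PEMV (on_obj Phi (N, I)) (on_obj Phi (N', I'))"
  then show "\<exists>!\<phi>. \<phi> \<in> Hom PMV (N, I) (N', I') \<and> h = on_mor Phi (N, I) (N', I') \<phi>"
    using full by blast
  fix \<phi> assume \<phi>: "\<phi> \<in> Hom PMV (N, I) (N', I') \<and> h = on_mor Phi (N, I) (N', I') \<phi>"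
  have c: "couple N I" "couple N' I'" and \<phi>': "\<phi> \<in> mv_hom N N'" "\<phi> ` I \<subseteq> I'" "h = restrict \<phi> I"
    using * \<phi> by (simp_all add: couple_iff)
  show "\<phi> ` carrier N = carrier N'" if "h ` I = I'"
    using hom_surj_if_surj_on_ideal[OF c \<phi>'(1)] that \<phi>'(3) by simp
  show "inj_on \<phi> (carrier N)" if "inj_on h I"
    using hom_inj_if_inj_on_ideal[OF c \<phi>'(1,2)] that \<phi>'(3) by simp
qed

end
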